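(* Every finite topological space is Morita-equivalent to a finite connectivity space: for every finite topological space $(E,\mathcal{T})$ there exists a finite connectivity space $(X,\mathcal{K})$ such that the categories $Sh(E,\mathcal{T})$ and $Sh(X,\mathcal{K})$ are equivalent.
   Context: A connectivity structure on a set $X$ is a set $\mathcal{K}\subset\mathcal{P}X$ of subsets (called connected) with $\emptyset\in\mathcal{K}$ such that the union of any family of members of $\mathcal{K}$ with non-empty intersection belongs to $\mathcal{K}$ (singletons need not be connected). The pair $(X,\mathcal{K})$ is a connectivity space; it is finite if $X$ is finite. For $\mathcal{A}\subset\mathcal{P}X$, $[\mathcal{A}]$ denotes the connectivity structure on $X$ generated by $\mathcal{A}$, i.e. the smallest (for inclusion) connectivity structure on $X$ containing $\mathcal{A}$. The poset $(\mathcal{K},\subset)$ is regarded as a small category. A sieve on $A\in\mathcal{K}$ is a pair $\sigma=(\dot\sigma,A)$ with $\dot\sigma\subset\mathcal{K}\cap\mathcal{P}A$ and $\mathcal{K}\cap\mathcal{P}B\subset\dot\sigma$ for all $B\in\dot\sigma$ (possibly $\dot\sigma=\emptyset$). The site of $(X,\mathcal{K})$ is $(\mathcal{K},J)$, where the covering sieves $J(A)$ of $A\in\mathcal{K}$ are the sieves $\sigma$ on $A$ with $[\dot\sigma]=\mathcal{K}\cap\mathcal{P}A$ (this is a Grothendieck topology), and $Sh(X,\mathcal{K})$ is the topos of sheaves of sets on $(\mathcal{K},J)$. For a topological space $(E,\mathcal{T})$ ($\mathcal{T}$ being the set of open sets), $Sh(E,\mathcal{T})$ is the usual topos of sheaves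 of sets on it. Two such objects are Morita-equivalent if their associated topoi are equivalent categories. *)

theory Defs
  imports "HOL-Analysis.Analysis"
begin

section \<open>Categories and their equivalence\<close>

text \<open>Hom-sets need not be disjoint, so composition and the action of a functor on
  arrows take the objects involved as arguments: \<open>cmp C a b c g f\<close> is the composite
  of \<open>f : a \<rightarrow> b\<close> and \<open>g : b \<rightarrow> c\<close>.\<close>

record ('o, 'm) cat =
  obj :: "'o set"
  arr :: "'o \<Rightarrow> 'o \<Rightarrow> 'm set"
  idt :: "'o \<Rightarrow> 'm"
  cmp :: "'o \<Rightarrow> 'o \<Rightarrow> 'o \<Rightarrow> 'm \<Rightarrow> 'm \<Rightarrow> 'm"

definition is_category :: "('o, 'm) cat \<Rightarrow> bool" where
  "is_category C \<longleftrightarrow>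
    (\<forall>a\<in>obj C. idt C a \<in> arr C a a) \<and>
    (\<forall>a\<in>obj C. \<forall>b\<in>obj C. \<forall>c\<in>obj C. \<forall>f\<in>arr C a b. \<forall>g\<in>arr C b c.
       cmp C a b c g f \<in> arr C a c) \<and>
    (\<forall>a\<in>obj C. \<forall>b\<in>obj C. \<forall>f\<in>arr C a b.
       cmp C a a b f (idt C a) = f \<and> cmp C a b b (idt C b) f = f) \<and>
    (\<forall>a\<in>obj C. \<forall>b\<in>obj C. \<forall>c\<in>obj C. \<forall>d\<in>obj C.
       \<forall>f\<in>arr C a b. \<forall>g\<in>arr C b c. \<forall>h\<in>arr C c d.
       cmp C a c d h (cmp C a b c g f) = cmp C a b d (cmp C b c d h g) f)"

record ('o1, 'm1, 'o2, 'm2) ftor =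
  fobj :: "'o1 \<Rightarrow> 'o2"
  farr :: "'o1 \<Rightarrow> 'o1 \<Rightarrow> 'm1 \<Rightarrow> 'm2"

definition is_functor ::
    "('o1, 'm1) cat \<Rightarrow> ('o2, 'm2) cat \<Rightarrow> ('o1, 'm1, 'o2, 'm2) ftor \<Rightarrow> bool" where
  "is_functor C D F \<longleftrightarrow>
    (\<forall>a\<in>obj C. fobj F a \<in> obj D) \<and>
    (\<forall>a\<in>obj C. \<forall>b\<in>obj C. \<forall>f\<in>arr C a b. farr F a b f \<in> arr D (fobj F a) (fobj F b)) \<and>
    (\<forall>a\<in>obj C. farr F a a (idt C a) = idt D (fobj F a)) \<and>
    (\<forall>a\<in>obj C. \<forall>b\<in>obj C. \<forall>c\<in>obj C. \<forall>f\<in>arr C a b. \<forall>g\<in>arr C b c.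
       farr F a c (cmp C a b c g f) =
       cmp D (fobj F a) (fobj F b) (fobj F c) (farr F b c g) (farr F a b f))"

definition id_functor :: "('o, 'm, 'o, 'm) ftor" where
  "id_functor = \<lparr>fobj = \<lambda>a. a, farr = \<lambda>a b f. f\<rparr>"

definition comp_functor ::
    "('o2, 'm2, 'o3, 'm3) ftor \<Rightarrow> ('o1, 'm1, 'o2, 'm2) ftor \<Rightarrow> ('o1, 'm1, 'o3, 'm3) ftor" where
  "comp_functor G F =
    \<lparr>fobj = \<lambda>a. fobj G (fobj F a),
     farr = \<lambda>a b f. farr G (fobj F a) (fobj F b) (farr F a b f)\<rparr>"

definition is_iso :: "('o, 'm) cat \<Rightarrow> 'o \<Rightarrow> 'o \<Rightarrow> 'm \<Rightarrow> bool" where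
  "is_iso C a b f \<longleftrightarrow> f \<in> arr C a b \<and>
    (\<exists>g\<in>arr C b a. cmp C a b a g f = idt C a \<and> cmp C b a b f g = idt C b)"

definition naturally_isomorphic ::
    "('o1, 'm1) cat \<Rightarrow> ('o2, 'm2) cat \<Rightarrow>
     ('o1, 'm1, 'o2, 'm2) ftor \<Rightarrow> ('o1, 'm1, 'o2, 'm2) ftor \<Rightarrow> bool" where
  "naturally_isomorphic C D F G \<longleftrightarrow>
    (\<exists>\<eta> :: 'o1 \<Rightarrow> 'm2.
      (\<forall>a\<in>obj C. is_iso D (fobj F a) (fobj G a) (\<eta> a)) \<and>
      (\<forall>a\<in>obj C. \<forall>b\<in>obj C. \<forall>f\<in>arr C a b.
         cmp D (fobj F a) (fobj F b) (fobj G b) (\<eta> b) (farr F a b f) =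
         cmp D (fobj F a) (fobj G a) (fobj G b) (farr G a b f) (\<eta> a)))"

definition equivalent_categories :: "('o1, 'm1) cat \<Rightarrow> ('o2, 'm2) cat \<Rightarrow> bool" where
  "equivalent_categories C D \<longleftrightarrow> is_category C \<and> is_category D \<and>
    (\<exists>F G. is_functor C D F \<and> is_functor D C G \<and>
       naturally_isomorphic C C id_functor (comp_functor G F) \<and>
       naturally_isomorphic D D (comp_functor F G) id_functor)"


section \<open>Sets\<close>

text \<open>HOL has no type of all sets.  The category of sets is rendered as the category of
  the members of a collection \<open>U\<close> of subsets of a type \<open>'v\<close>, with all functions between
  them, where \<open>U\<close> is any collection with the closure properties below.  If \<open>'v\<close> is a type
  of ZF sets (or carries a Grothendieck universe), \<open>U\<close> can be the collection of all small
  sets; other examples are all subsets of an infinite type and all finite subsets of an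
  infinite type.\<close>

definition set_universe :: "'v set set \<Rightarrow> bool" where
  "set_universe U \<longleftrightarrow>
    (\<exists>A\<in>U. A \<noteq> {}) \<and>
    (\<forall>A\<in>U. \<forall>B :: 'v set. B \<lesssim> A \<longrightarrow> B \<in> U) \<and>
    (\<forall>A\<in>U. \<forall>B\<in>U. \<exists>C\<in>U. A \<times> B \<lesssim> C)"

lemma set_universe_UNIV:
  assumes "infinite (UNIV :: 'v set)"
  shows "set_universe (UNIV :: 'v set set)"
proof -
  have "A \<times> B \<lesssim> (UNIV :: 'v set)" for A B :: "'v set"
  proof -
    have "A \<times> B \<lesssim> (UNIV :: 'v set) \<times> (UNIV :: 'v set)"
      by (intro subset_imp_lepoll) auto
    also have "(UNIV :: 'v set) \<times> (UNIV :: 'v set) \<lesssim> (UNIV :: 'v set)"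
      using card_of_Times_same_infinite[OF assms]
      by (meson card_of_ordIso eqpoll_def eqpoll_imp_lepoll)
    finally show ?thesis .
  qed
  then show ?thesis
    unfolding set_universe_def by blast
qed

lemma set_universe_finite:
  assumes "infinite (UNIV :: 'v set)"
  shows "set_universe {A :: 'v set. finite A}"
proof -
  have 1: "finite B" if "finite A" "B \<lesssim> A" for A B :: "'v set"
    using that by (meson inj_on_finite lepoll_def)
  have 2: "\<exists>C::'v set. finite C \<and> A \<times> B \<lesssim> C" if "finite A" "finite B" for A B :: "'v set"
  proof -
    obtain C :: "'v set" where C: "finite C" "card C = card (A \<times> B)"
      using infinite_arbitrarily_large[OF assms] by blast
    then have "A \<times> B \<lesssim> C"
      unfolding lepoll_def using that card_le_inj[of "A \<times> B" C] by auto
    with C show ?thesis by blast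
  qed
  have "{undefined :: 'v} \<in> {A. finite A}" by simp
  with 1 2 show ?thesis
    unfolding set_universe_def by (metis (no_types, lifting) insert_not_empty mem_Collect_eq)
qed


section \<open>Presheaves on a collection of sets ordered by inclusion\<close>

text \<open>A presheaf on the poset \<open>P\<close> of sets is a contravariant functor from \<open>(P, \<subseteq>)\<close> to the
  sets in \<open>U\<close>; \<open>restr F A B\<close> is the restriction from \<open>A\<close> to \<open>B \<subseteq> A\<close>.  Values of \<open>sections\<close> and
  \<open>restr\<close> at arguments outside this range are irrelevant: presheaves
  differing only there are isomorphic by the identity.  Morphisms are families of functions, so
  they have to be extensional.\<close>

record ('a, 'v) presheaf =
  sections :: "'a set \<Rightarrow> 'v set"
  restr :: "'a set \<Rightarrow> 'a set \<Rightarrow> 'v \<Rightarrow> 'v"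

definition is_presheaf :: "'v set set \<Rightarrow> 'a set set \<Rightarrow> ('a, 'v) presheaf \<Rightarrow> bool" where
  "is_presheaf U P F \<longleftrightarrow>
    (\<forall>A\<in>P. sections F A \<in> U) \<and>
    (\<forall>A\<in>P. \<forall>B\<in>P. B \<subseteq> A \<longrightarrow> restr F A B \<in> sections F A \<rightarrow> sections F B) \<and>
    (\<forall>A\<in>P. \<forall>x\<in>sections F A. restr F A A x = x) \<and>
    (\<forall>A\<in>P. \<forall>B\<in>P. \<forall>C\<in>P. C \<subseteq> B \<and> B \<subseteq> A \<longrightarrow>
       (\<forall>x\<in>sections F A. restr F B C (restr F A B x) = restr F A C x))"

definition presheaf_morphisms ::
    "'a set set \<Rightarrow> ('a, 'v) presheaf \<Rightarrow> ('a, 'v) presheaf \<Rightarrow> ('a set \<Rightarrow> 'v \<Rightarrow> 'v) set" where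
  "presheaf_morphisms P F G =
    {\<eta> \<in> (\<Pi>\<^sub>E A\<in>P. sections F A \<rightarrow>\<^sub>E sections G A).
       \<forall>A\<in>P. \<forall>B\<in>P. B \<subseteq> A \<longrightarrow>
         (\<forall>x\<in>sections F A. \<eta> B (restr F A B x) = restr G A B (\<eta> A x))}"

text \<open>The full subcategory of presheaves on \<open>P\<close> with the objects satisfying \<open>Q\<close>.\<close>

definition presheaf_category ::
    "'v set set \<Rightarrow> 'a set set \<Rightarrow> (('a, 'v) presheaf \<Rightarrow> bool) \<Rightarrow>
     (('a, 'v) presheaf, 'a set \<Rightarrow> 'v \<Rightarrow> 'v) cat" where
  "presheaf_category U P Q =
    \<lparr>obj = {F. is_presheaf U P F \<and> Q F},
     arr = presheaf_morphisms P,
     idt = (\<lambda>F. \<lambda>A\<in>P. \<lambda>x\<in>sections F A. x),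
     cmp = (\<lambda>F G H \<theta> \<eta>. \<lambda>A\<in>P. compose (sections F A) (\<theta> A) (\<eta> A))\<rparr>"


section \<open>Sheaves on a topological space\<close>

definition top_sheaf :: "'a topology \<Rightarrow> ('a, 'v) presheaf \<Rightarrow> bool" where
  "top_sheaf T F \<longleftrightarrow>
    (\<forall>\<W>. (\<forall>W\<in>\<W>. openin T W) \<longrightarrow>
      (\<forall>s\<in>(\<Pi> W\<in>\<W>. sections F W).
        (\<forall>V\<in>\<W>. \<forall>W\<in>\<W>. restr F V (V \<inter> W) (s V) = restr F W (V \<inter> W) (s W)) \<longrightarrow>
        (\<exists>!x. x \<in> sections F (\<Union>\<W>) \<and> (\<forall>W\<in>\<W>. restr F (\<Union>\<W>) W x = s W))))"

definition Sh_top ::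
    "'v set set \<Rightarrow> 'a topology \<Rightarrow> (('a, 'v) presheaf, 'a set \<Rightarrow> 'v \<Rightarrow> 'v) cat" where
  "Sh_top U T = presheaf_category U {W. openin T W} (top_sheaf T)"


section \<open>Connectivity spaces and their sheaves\<close>

text \<open>The empty subfamily is harmless in the union axiom, since its union \<open>{}\<close> is in \<open>K\<close>.\<close>

definition connectivity_space :: "'a set \<Rightarrow> 'a set set \<Rightarrow> bool" where
  "connectivity_space X K \<longleftrightarrow> K \<subseteq> Pow X \<and> {} \<in> K \<and>
    (\<forall>\<A>. \<A> \<subseteq> K \<and> \<Inter>\<A> \<noteq> {} \<longrightarrow> \<Union>\<A> \<in> K)"

definition generated_connectivity :: "'a set \<Rightarrow> 'a set set \<Rightarrow> 'a set set" where
  "generated_connectivity X \<A> = \<Inter>{K. connectivity_space X K \<and> \<A> \<subseteq> K}"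

text \<open>A sieve on \<open>A\<close> is given by its set of members, \<open>A\<close> being a parameter.\<close>

definition is_sieve :: "'a set set \<Rightarrow> 'a set \<Rightarrow> 'a set set \<Rightarrow> bool" where
  "is_sieve K A \<sigma> \<longleftrightarrow> \<sigma> \<subseteq> K \<inter> Pow A \<and> (\<forall>B\<in>\<sigma>. K \<inter> Pow B \<subseteq> \<sigma>)"

definition covering_sieves :: "'a set \<Rightarrow> 'a set set \<Rightarrow> 'a set \<Rightarrow> 'a set set set" where
  "covering_sieves X K A =
    {\<sigma>. is_sieve K A \<sigma> \<and> generated_connectivity X \<sigma> = K \<inter> Pow A}"

text \<open>Sheaves on the poset \<open>P\<close> with covering sieves \<open>J\<close>: every matching family on a covering
  sieve has a unique amalgamation.\<close>

definition site_sheaf ::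
    "'a set set \<Rightarrow> ('a set \<Rightarrow> 'a set set set) \<Rightarrow> ('a, 'v) presheaf \<Rightarrow> bool" where
  "site_sheaf P J F \<longleftrightarrow>
    (\<forall>A\<in>P. \<forall>\<sigma>\<in>J A. \<forall>s\<in>(\<Pi> B\<in>\<sigma>. sections F B).
      (\<forall>B\<in>\<sigma>. \<forall>C\<in>P. C \<subseteq> B \<longrightarrow> restr F B C (s B) = s C) \<longrightarrow>
      (\<exists>!x. x \<in> sections F A \<and> (\<forall>B\<in>\<sigma>. restr F A B x = s B)))"

definition Sh_conn ::
    "'v set set \<Rightarrow> 'a set \<Rightarrow> 'a set set \<Rightarrow> (('a, 'v) presheaf, 'a set \<Rightarrow> 'v \<Rightarrow> 'v) cat" where
  "Sh_conn U X K = presheaf_category U K (site_sheaf K (covering_sieves X K))"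

end

theory Submission
  imports Defs
begin

text \<open>Let \<open>B\<close> be the family of minimal open neighbourhoods of the points of \<open>(E, T)\<close>, and take the
  connectivity structure \<open>K = [B]\<close> on \<open>E\<close>.  Members of \<open>K\<close> are open, and a member of \<open>B\<close> contained in a
  union of open sets is contained in one of them.  Hence a sieve on \<open>A \<in> K\<close> covers iff it contains every
  \<open>b \<in> B\<close> with \<open>b \<subseteq> A\<close>, and on both sides a sheaf is a presheaf whose value at \<open>A\<close> is the limit of its
  values at these \<open>b\<close>.  Restriction from the open sets to \<open>K\<close> is then an equivalence, both
  categories being equivalent to the presheaves on \<open>B\<close>.\<close>

section \<open>Fully faithful and essentially surjective functors\<close>

text \<open>For the discrete space with two points the whole space is open but not in
  \<open>K\<close>, and in general the intersection of two members of \<open>B\<close> need not lie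
  in \<open>K\<close>. Covers on the two sides therefore cannot be matched one by one; both sheaf
  conditions are translated into the common condition \<open>locally_determined\<close> instead. The
  category of presheaves on \<open>B\<close> is never formed: as \<open>K\<close> lies between
  \<open>B\<close> and the family of open sets, restriction to \<open>K\<close> is shown directly to
  be fully faithful and essentially surjective. A singleton in \<open>K\<close> has to be open, so
  the construction relies on singletons being allowed to be disconnected. The empty set lies in
  \<open>K\<close>, but no member of \<open>B\<close> lies below it: the limit there is empty, which
  forces exactly one section. Finiteness acts twice: it makes minimal neighbourhoods open, and it
  places the limits that define an extension inside finite products, whose size is bounded by a
  member of \<open>U\<close>.\<close>

lemma category_id: "is_category C \<Longrightarrow> a \<in> obj C \<Longrightarrow> idt C a \<in> arr C a a"
  by (simp add: is_category_def)

lemma category_comp: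
  "is_category C \<Longrightarrow> f \<in> arr C a b \<Longrightarrow> g \<in> arr C b c \<Longrightarrow>
   a \<in> obj C \<Longrightarrow> b \<in> obj C \<Longrightarrow> c \<in> obj C \<Longrightarrow> cmp C a b c g f \<in> arr C a c"
  by (simp add: is_category_def)

lemma category_id_right:
  "is_category C \<Longrightarrow> f \<in> arr C a b \<Longrightarrow> a \<in> obj C \<Longrightarrow> b \<in> obj C \<Longrightarrow> cmp C a a b f (idt C a) = f"
  by (simp add: is_category_def)

lemma category_id_left:
  "is_category C \<Longrightarrow> f \<in> arr C a b \<Longrightarrow> a \<in> obj C \<Longrightarrow> b \<in> obj C \<Longrightarrow> cmp C a b b (idt C b) f = f"
  by (simp add: is_category_def)

lemma category_assoc:
  "is_category C \<Longrightarrow> f \<in> arr C a b \<Longrightarrow> g \<in> arr C b c \<Longrightarrow> h \<in> arr C c d \<Longrightarrow>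
   a \<in> obj C \<Longrightarrow> b \<in> obj C \<Longrightarrow> c \<in> obj C \<Longrightarrow> d \<in> obj C \<Longrightarrow>
   cmp C a b d (cmp C b c d h g) f = cmp C a c d h (cmp C a b c g f)"
  by (simp add: is_category_def)

lemma functor_obj: "is_functor C D F \<Longrightarrow> a \<in> obj C \<Longrightarrow> fobj F a \<in> obj D"
  by (simp add: is_functor_def)

lemma functor_arr:
  "is_functor C D F \<Longrightarrow> f \<in> arr C a b \<Longrightarrow> a \<in> obj C \<Longrightarrow> b \<in> obj C \<Longrightarrow>
   farr F a b f \<in> arr D (fobj F a) (fobj F b)"
  by (simp add: is_functor_def)

lemma functor_id: "is_functor C D F \<Longrightarrow> a \<in> obj C \<Longrightarrow> farr F a a (idt C a) = idt D (fobj F a)"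
  by (simp add: is_functor_def)

lemma functor_comp:
  "is_functor C D F \<Longrightarrow> f \<in> arr C a b \<Longrightarrow> g \<in> arr C b c \<Longrightarrow>
   a \<in> obj C \<Longrightarrow> b \<in> obj C \<Longrightarrow> c \<in> obj C \<Longrightarrow>
   farr F a c (cmp C a b c g f) =
   cmp D (fobj F a) (fobj F b) (fobj F c) (farr F b c g) (farr F a b f)"
  by (simp add: is_functor_def)

text \<open>Choose for every \<open>d\<close> an object \<open>g d\<close> and an isomorphism
  \<open>e d\<close> from its image to \<open>d\<close>. The inverse functor sends an arrow to the
  preimage under \<open>F\<close> of its conjugate by \<open>e\<close>. Equations in
  \<open>C\<close> are checked after applying \<open>F\<close>, which is faithful.\<close>

lemma equivalent_categories_if_fully_faithful_essentially_surjective: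
  assumes C: "is_category C" and D: "is_category D" and F: "is_functor C D F"
    and ff: "\<And>a b. a \<in> obj C \<Longrightarrow> b \<in> obj C \<Longrightarrow>
      bij_betw (farr F a b) (arr C a b) (arr D (fobj F a) (fobj F b))"
    and es: "\<And>d. d \<in> obj D \<Longrightarrow> \<exists>c\<in>obj C. \<exists>e. is_iso D (fobj F c) d e"
  shows "equivalent_categories C D"
proof -
  have "\<forall>d. \<exists>c e e'. d \<in> obj D \<longrightarrow> c \<in> obj C \<and> e \<in> arr D (fobj F c) d \<and> e' \<in> arr D d (fobj F c) \<and>
      cmp D (fobj F c) d (fobj F c) e' e = idt D (fobj F c) \<and>
      cmp D d (fobj F c) d e e' = idt D d"
    using es unfolding is_iso_def by meson
  then obtain g e e' where
    all: "\<forall>d. d \<in> obj D \<longrightarrow> g d \<in> obj C \<and> e d \<in> arr D (fobj F (g d)) d \<and> e' d \<in> arr D d (fobj F (g d)) \<and>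
      cmp D (fobj F (g d)) d (fobj F (g d)) (e' d) (e d) = idt D (fobj F (g d)) \<and>
      cmp D d (fobj F (g d)) d (e d) (e' d) = idt D d"
    by metis
  then have g: "\<And>d. d \<in> obj D \<Longrightarrow> g d \<in> obj C"
    and e: "\<And>d. d \<in> obj D \<Longrightarrow> e d \<in> arr D (fobj F (g d)) d"
    and e': "\<And>d. d \<in> obj D \<Longrightarrow> e' d \<in> arr D d (fobj F (g d))"
    and e'e: "\<And>d. d \<in> obj D \<Longrightarrow> cmp D (fobj F (g d)) d (fobj F (g d)) (e' d) (e d) = idt D (fobj F (g d))"
    and ee': "\<And>d. d \<in> obj D \<Longrightarrow> cmp D d (fobj F (g d)) d (e d) (e' d) = idt D d"
    by blast+
  define lift where "lift a b = inv_into (arr C a b) (farr F a b)" for a b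
  have lift: "lift a b h \<in> arr C a b" "farr F a b (lift a b h) = h"
    if "h \<in> arr D (fobj F a) (fobj F b)" "a \<in> obj C" "b \<in> obj C" for a b h
    using ff[OF that(2,3)] that(1) unfolding lift_def
    by (auto simp: bij_betw_def inv_into_into f_inv_into_f)
  have faithful: "f = f'"
    if "farr F a b f = farr F a b f'" "f \<in> arr C a b" "f' \<in> arr C a b" "a \<in> obj C" "b \<in> obj C"
    for a b f f'
    using ff[OF that(4,5)] that(1-3) by (auto simp: bij_betw_def inj_on_def)
  note cat = category_id[OF C] category_id[OF D] category_comp[OF C] category_comp[OF D]
    category_id_left[OF C] category_id_left[OF D] category_id_right[OF C] category_id_right[OF D]
    category_assoc[OF D] functor_obj[OF F] functor_arr[OF F] functor_id[OF F] functor_comp[OF F]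
    lift g e e' e'e ee'
  \<comment> \<open>\<open>category_assoc\<close> nests composites to the right, where
    \<open>e d\<close> and \<open>e' d\<close> are no longer the two arguments of one
    \<open>cmp\<close>; this is the form of \<open>ee'\<close> that still rewrites there.\<close>
  have cancel: "cmp D c (fobj F (g d)) d (e d) (cmp D c d (fobj F (g d)) (e' d) k) = k"
    if "k \<in> arr D c d" "c \<in> obj D" "d \<in> obj D" for c d k
    using that by (simp add: category_assoc[OF D, symmetric] category_id_left[OF D] e e' ee' functor_obj[OF F] g)
  define G where "G = \<lparr>fobj = g, farr = \<lambda>d1 d2 h. lift (g d1) (g d2)
    (cmp D (fobj F (g d1)) d2 (fobj F (g d2)) (e' d2) (cmp D (fobj F (g d1)) d1 d2 h (e d1)))\<rparr>"
  have G: "is_functor D C G"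
    unfolding is_functor_def
  proof (intro conjI ballI)
    fix a b c f h
    assume *: "a \<in> obj D" "b \<in> obj D" "c \<in> obj D" "f \<in> arr D a b" "h \<in> arr D b c"
    show "farr G a c (cmp D a b c h f) = cmp C (fobj G a) (fobj G b) (fobj G c) (farr G b c h) (farr G a b f)"
      by (rule faithful[where a = "g a" and b = "g c"]) (use * in \<open>simp_all add: G_def cat cancel\<close>)
  next
    fix a assume "a \<in> obj D"
    then show "farr G a a (idt D a) = idt C (fobj G a)"
      by (intro faithful[where a = "g a" and b = "g a"]) (simp_all add: G_def cat)
  qed (simp_all add: G_def cat)
  have 1: "naturally_isomorphic C C id_functor (comp_functor G F)"
    unfolding naturally_isomorphic_def
  proof (intro exI conjI ballI)
    fix a assume a: "a \<in> obj C"
    \<comment> \<open>The unit at \<open>a\<close> is the preimage under \<open>F\<close> of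
      \<open>e' (fobj F a)\<close>, and its inverse the preimage of
      \<open>e (fobj F a)\<close>.\<close>
    show "is_iso C (fobj id_functor a) (fobj (comp_functor G F) a) (lift a (g (fobj F a)) (e' (fobj F a)))"
      unfolding is_iso_def
    proof (intro conjI bexI[of _ "lift (g (fobj F a)) a (e (fobj F a))"])
      let ?b = "g (fobj F a)"
      show "cmp C (fobj id_functor a) (fobj (comp_functor G F) a) (fobj id_functor a)
          (lift ?b a (e (fobj F a))) (lift a ?b (e' (fobj F a))) = idt C (fobj id_functor a)"
        by (rule faithful[where a = a and b = a])
          (use a in \<open>simp_all add: id_functor_def comp_functor_def G_def cat\<close>)
      show "cmp C (fobj (comp_functor G F) a) (fobj id_functor a) (fobj (comp_functor G F) a)
          (lift a ?b (e' (fobj F a))) (lift ?b a (e (fobj F a))) = idt C (fobj (comp_functor G F) a)"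
        by (rule faithful[where a = ?b and b = ?b])
          (use a in \<open>simp_all add: id_functor_def comp_functor_def G_def cat\<close>)
    qed (use a in \<open>simp_all add: id_functor_def comp_functor_def G_def cat\<close>)
  next
    fix a b f assume *: "a \<in> obj C" "b \<in> obj C" "f \<in> arr C a b"
    show "cmp C (fobj id_functor a) (fobj id_functor b) (fobj (comp_functor G F) b)
            (lift b (g (fobj F b)) (e' (fobj F b))) (farr id_functor a b f) =
          cmp C (fobj id_functor a) (fobj (comp_functor G F) a) (fobj (comp_functor G F) b)
            (farr (comp_functor G F) a b f) (lift a (g (fobj F a)) (e' (fobj F a)))"
      by (rule faithful[where a = a and b = "g (fobj F b)"]) (use * in \<open>simp_all add: id_functor_def comp_functor_def G_def cat\<close>)
  qed
  have 2: "naturally_isomorphic D D (comp_functor F G) id_functor"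
    unfolding naturally_isomorphic_def
  proof (intro exI[of _ e] conjI ballI)
    fix d assume "d \<in> obj D"
    then show "is_iso D (fobj (comp_functor F G) d) (fobj id_functor d) (e d)"
      unfolding is_iso_def
      by (intro conjI bexI[of _ "e' d"]) (simp_all add: id_functor_def comp_functor_def G_def cat)
  next
    fix a b f assume *: "a \<in> obj D" "b \<in> obj D" "f \<in> arr D a b"
    then show "cmp D (fobj (comp_functor F G) a) (fobj (comp_functor F G) b) (fobj id_functor b)
          (e b) (farr (comp_functor F G) a b f) =
        cmp D (fobj (comp_functor F G) a) (fobj id_functor a) (fobj id_functor b)
          (farr id_functor a b f) (e a)"
      by (simp add: id_functor_def comp_functor_def G_def cat cancel)
  qed
  show ?thesis
    unfolding equivalent_categories_def using C D F G 1 2 by blast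
qed

section \<open>Categories of presheaves\<close>

lemma restr_in:
  "is_presheaf U P F \<Longrightarrow> x \<in> sections F A \<Longrightarrow> B \<subseteq> A \<Longrightarrow> A \<in> P \<Longrightarrow> B \<in> P \<Longrightarrow> restr F A B x \<in> sections F B"
  by (simp add: is_presheaf_def Pi_iff)

lemma restr_restr:
  "is_presheaf U P F \<Longrightarrow> x \<in> sections F A \<Longrightarrow> B \<subseteq> A \<Longrightarrow> C \<subseteq> B \<Longrightarrow> A \<in> P \<Longrightarrow> B \<in> P \<Longrightarrow> C \<in> P \<Longrightarrow>
   restr F B C (restr F A B x) = restr F A C x"
  by (simp add: is_presheaf_def)

lemma is_presheaf_subset: "is_presheaf U P F \<Longrightarrow> K \<subseteq> P \<Longrightarrow> is_presheaf U K F"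
  unfolding is_presheaf_def by (meson subsetD)

lemma presheaf_morphism_in:
  "\<eta> \<in> presheaf_morphisms P F G \<Longrightarrow> A \<in> P \<Longrightarrow> x \<in> sections F A \<Longrightarrow> \<eta> A x \<in> sections G A"
  by (auto simp: presheaf_morphisms_def PiE_def Pi_def)

lemma presheaf_morphism_natural:
  "\<eta> \<in> presheaf_morphisms P F G \<Longrightarrow> A \<in> P \<Longrightarrow> B \<in> P \<Longrightarrow> B \<subseteq> A \<Longrightarrow> x \<in> sections F A \<Longrightarrow>
   \<eta> B (restr F A B x) = restr G A B (\<eta> A x)"
  by (simp add: presheaf_morphisms_def)

lemma presheaf_morphism_eqI:
  assumes "\<eta> \<in> presheaf_morphisms P F G" "\<theta> \<in> presheaf_morphisms P F' G'"
    and eq: "\<And>A x. A \<in> P \<Longrightarrow> x \<in> sections F A \<Longrightarrow> \<eta> A x = \<theta> A x"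
    and "\<And>A. A \<in> P \<Longrightarrow> sections F' A = sections F A"
  shows "\<eta> = \<theta>"
proof (rule extensionalityI[of _ P])
  show "\<eta> \<in> extensional P" "\<theta> \<in> extensional P"
    using assms by (auto simp: presheaf_morphisms_def PiE_def)
  fix A assume A: "A \<in> P"
  show "\<eta> A = \<theta> A"
  proof (rule extensionalityI)
    show "\<eta> A \<in> extensional (sections F A)" "\<theta> A \<in> extensional (sections F A)"
      using assms A by (auto simp: presheaf_morphisms_def PiE_def Pi_def)
  qed (use A eq in auto)
qed

text \<open>The membership of \<open>restr F A B x\<close> is part of the second premise because it
  is what lets the bounded abstraction over \<open>sections F B\<close> be evaluated at that
  point.\<close>

lemma presheaf_morphismI:
  assumes "\<And>A x. A \<in> P \<Longrightarrow> x \<in> sections F A \<Longrightarrow> h A x \<in> sections G A"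
    and "\<And>A B x. A \<in> P \<Longrightarrow> B \<in> P \<Longrightarrow> B \<subseteq> A \<Longrightarrow> x \<in> sections F A \<Longrightarrow>
      restr F A B x \<in> sections F B \<and> h B (restr F A B x) = restr G A B (h A x)"
  shows "(\<lambda>A\<in>P. \<lambda>x\<in>sections F A. h A x) \<in> presheaf_morphisms P F G"
  unfolding presheaf_morphisms_def using assms by (auto simp: PiE_def Pi_def)

lemma is_category_presheaf_category: "is_category (presheaf_category U P Q)"
proof -
  have comp: "(\<lambda>A\<in>P. compose (sections F A) (\<theta> A) (\<eta> A)) \<in> presheaf_morphisms P F H"
    if "is_presheaf U P F" "\<eta> \<in> presheaf_morphisms P F G" "\<theta> \<in> presheaf_morphisms P G H"
    for F G H \<eta> \<theta>
    unfolding compose_def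
    by (rule presheaf_morphismI)
      (simp_all add: presheaf_morphism_in[OF that(2)] presheaf_morphism_in[OF that(3)]
        presheaf_morphism_natural[OF that(2)] presheaf_morphism_natural[OF that(3)] restr_in[OF that(1)])
  have id: "(\<lambda>A\<in>P. \<lambda>x\<in>sections F A. x) \<in> presheaf_morphisms P F F"
    if "is_presheaf U P F" for F
    by (rule presheaf_morphismI) (auto intro: restr_in[OF that])
  show ?thesis
    unfolding is_category_def presheaf_category_def
    apply (simp only: cat.select_convs mem_Collect_eq)
    apply (intro conjI ballI)
    subgoal by (simp add: id)
    subgoal by (simp add: comp)
    subgoal for F G \<eta>
      by (rule presheaf_morphism_eqI[where F = F and G = G and F' = F and G' = G], (blast intro: comp id)+)
        (auto simp: compose_def)
    subgoal for F G \<eta>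
      by (rule presheaf_morphism_eqI[where F = F and G = G and F' = F and G' = G], (blast intro: comp id)+)
        (auto simp: compose_def presheaf_morphism_in)
    subgoal for F G H I \<eta> \<theta> \<zeta>
      by (rule presheaf_morphism_eqI[where F = F and G = I and F' = F and G' = I], (blast intro: comp id)+)
        (auto simp: compose_def presheaf_morphism_in)
    done
qed

text \<open>Naturality of the pointwise inverse comes for free: the naturality square of
  \<open>\<eta>\<close> at the preimage of \<open>y\<close> becomes that of the inverse once the
  inverse at \<open>B\<close> is applied.\<close>

lemma is_iso_presheaf_category:
  assumes F: "is_presheaf U P F" and G: "is_presheaf U P G"
    and \<eta>: "\<eta> \<in> presheaf_morphisms P F G"
    and bij: "\<And>A. A \<in> P \<Longrightarrow> bij_betw (\<eta> A) (sections F A) (sections G A)"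
  shows "is_iso (presheaf_category U P Q) F G \<eta>"
proof -
  define \<theta> where "\<theta> = (\<lambda>A\<in>P. \<lambda>y\<in>sections G A. inv_into (sections F A) (\<eta> A) y)"
  have inv: "inv_into (sections F A) (\<eta> A) y \<in> sections F A"
    "\<eta> A (inv_into (sections F A) (\<eta> A) y) = y" if "A \<in> P" "y \<in> sections G A" for A y
    using bij[OF that(1)] that(2)
    by (auto simp: bij_betw_def inv_into_into f_inv_into_f)
  have inv': "inv_into (sections F A) (\<eta> A) (\<eta> A x) = x" if "A \<in> P" "x \<in> sections F A" for A x
    using bij[OF that(1)] that(2) by (simp add: bij_betw_inv_into_left)
  have nat: "inv_into (sections F B) (\<eta> B) (restr G A B y) = restr F A B (inv_into (sections F A) (\<eta> A) y)"
    if "A \<in> P" "B \<in> P" "B \<subseteq> A" "y \<in> sections G A" for A B y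
    using that presheaf_morphism_natural[OF \<eta> that(1-3) inv(1)[OF that(1,4)]]
    by (metis inv inv' restr_in[OF F])
  have \<theta>: "\<theta> \<in> presheaf_morphisms P G F"
    unfolding \<theta>_def by (rule presheaf_morphismI) (use inv nat in \<open>auto intro: restr_in[OF G]\<close>)
  show ?thesis
    unfolding is_iso_def presheaf_category_def
    using \<eta> \<theta> by (auto intro!: bexI[of _ \<theta>] ext
        simp: compose_def restrict_def presheaf_morphism_in[OF \<eta>] inv inv' \<theta>_def)
qed

section \<open>Presheaves determined by their restriction to a subfamily\<close>

text \<open>The value at \<open>A\<close> is the limit of the values at the members of \<open>B\<close> below \<open>A\<close>: the presheaf is the
  right Kan extension of its restriction to \<open>B\<close>.\<close>

definition locally_determined :: "'a set set \<Rightarrow> 'a set set \<Rightarrow> ('a, 'v) presheaf \<Rightarrow> bool" where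
  "locally_determined P B F \<longleftrightarrow>
    (\<forall>A\<in>P. \<forall>s\<in>(\<Pi> b\<in>B \<inter> Pow A. sections F b).
      (\<forall>b\<in>B \<inter> Pow A. \<forall>c\<in>B \<inter> Pow b. restr F b c (s b) = s c) \<longrightarrow>
      (\<exists>!x. x \<in> sections F A \<and> (\<forall>b\<in>B \<inter> Pow A. restr F A b x = s b)))"

lemma locally_determined_subset: "locally_determined P B F \<Longrightarrow> K \<subseteq> P \<Longrightarrow> locally_determined K B F"
  by (simp add: locally_determined_def subset_iff)

lemma locally_determined_glue:
  assumes "locally_determined P B F" "A \<in> P"
    and "\<And>b. b \<in> B \<Longrightarrow> b \<subseteq> A \<Longrightarrow> s b \<in> sections F b"
    and "\<And>b c. b \<in> B \<Longrightarrow> c \<in> B \<Longrightarrow> b \<subseteq> A \<Longrightarrow> c \<subseteq> b \<Longrightarrow> restr F b c (s b) = s c"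
  obtains x where "x \<in> sections F A" "\<And>b. b \<in> B \<Longrightarrow> b \<subseteq> A \<Longrightarrow> restr F A b x = s b"
proof -
  have 1: "s \<in> (\<Pi> b\<in>B \<inter> Pow A. sections F b)"
    using assms(3) by auto
  have 2: "\<forall>b\<in>B \<inter> Pow A. \<forall>c\<in>B \<inter> Pow b. restr F b c (s b) = s c"
    using assms(4) by auto
  have "\<exists>!x. x \<in> sections F A \<and> (\<forall>b\<in>B \<inter> Pow A. restr F A b x = s b)"
    using assms(1,2) 1 2 by (simp add: locally_determined_def)
  then show ?thesis
    using that by blast
qed

text \<open>Both sections amalgamate the matching family formed by the restrictions of
  \<open>x\<close>.\<close>

lemma locally_determined_eqI:
  assumes "locally_determined P B F" "is_presheaf U P F" "B \<subseteq> P" "A \<in> P" "x \<in> sections F A" "y \<in> sections F A"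
    and eq: "\<And>b. b \<in> B \<Longrightarrow> b \<subseteq> A \<Longrightarrow> restr F A b x = restr F A b y"
  shows "x = y"
proof -
  have "(\<lambda>b. restr F A b x) \<in> (\<Pi> b\<in>B \<inter> Pow A. sections F b)"
    using assms(3-5) restr_in[OF assms(2)] by auto
  moreover have "\<forall>b\<in>B \<inter> Pow A. \<forall>c\<in>B \<inter> Pow b. restr F b c (restr F A b x) = restr F A c x"
    using assms(3-5) restr_restr[OF assms(2)] by (auto simp: subset_iff)
  ultimately have "\<exists>!z. z \<in> sections F A \<and> (\<forall>b\<in>B \<inter> Pow A. restr F A b z = restr F A b x)"
    using bspec[OF bspec[OF assms(1)[unfolded locally_determined_def] assms(4)], of "\<lambda>b. restr F A b x"]
    by blast
  then show ?thesis
    using assms(5,6) eq by (metis Int_iff PowD)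
qed

lemma locally_determinedI:
  assumes "\<And>A s. A \<in> P \<Longrightarrow> (\<And>b. b \<in> B \<Longrightarrow> b \<subseteq> A \<Longrightarrow> s b \<in> sections F b) \<Longrightarrow>
      (\<And>b c. b \<in> B \<Longrightarrow> c \<in> B \<Longrightarrow> b \<subseteq> A \<Longrightarrow> c \<subseteq> b \<Longrightarrow> restr F b c (s b) = s c) \<Longrightarrow>
      \<exists>x\<in>sections F A. \<forall>b\<in>B. b \<subseteq> A \<longrightarrow> restr F A b x = s b"
    and "\<And>A x y. A \<in> P \<Longrightarrow> x \<in> sections F A \<Longrightarrow> y \<in> sections F A \<Longrightarrow>
      (\<And>b. b \<in> B \<Longrightarrow> b \<subseteq> A \<Longrightarrow> restr F A b x = restr F A b y) \<Longrightarrow> x = y"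
  shows "locally_determined P B F"
  unfolding locally_determined_def
proof (intro ballI impI)
  fix A s assume A: "A \<in> P" and s: "s \<in> (\<Pi> b\<in>B \<inter> Pow A. sections F b)"
    and m: "\<forall>b\<in>B \<inter> Pow A. \<forall>c\<in>B \<inter> Pow b. restr F b c (s b) = s c"
  have "\<exists>x\<in>sections F A. \<forall>b\<in>B. b \<subseteq> A \<longrightarrow> restr F A b x = s b"
    by (rule assms(1)[OF A]) (use s m in \<open>auto simp: Pi_iff\<close>)
  then show "\<exists>!x. x \<in> sections F A \<and> (\<forall>b\<in>B \<inter> Pow A. restr F A b x = s b)"
    using assms(2)[OF A] by (intro ex_ex1I) (blast, simp)
qed

text \<open>The presheaf itself is unchanged, as its values outside \<open>K\<close> do not matter over \<open>K\<close>.\<close>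

definition restriction_functor ::
    "'a set set \<Rightarrow> (('a, 'v) presheaf, 'a set \<Rightarrow> 'v \<Rightarrow> 'v, ('a, 'v) presheaf, 'a set \<Rightarrow> 'v \<Rightarrow> 'v) ftor" where
  "restriction_functor K = \<lparr>fobj = \<lambda>F. F, farr = \<lambda>F G \<eta>. restrict \<eta> K\<rparr>"

section \<open>The restriction functor and its full faithfulness\<close>

lemma restrict_presheaf_morphism:
  "\<eta> \<in> presheaf_morphisms P F G \<Longrightarrow> K \<subseteq> P \<Longrightarrow> restrict \<eta> K \<in> presheaf_morphisms K F G"
  unfolding presheaf_morphisms_def by (auto simp: PiE_def Pi_def subset_iff)

lemma is_functor_restriction:
  assumes "K \<subseteq> P" and "\<And>F. is_presheaf U P F \<Longrightarrow> Q F \<Longrightarrow> Q' F"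
  shows "is_functor (presheaf_category U P Q) (presheaf_category U K Q') (restriction_functor K)"
  unfolding is_functor_def presheaf_category_def restriction_functor_def
  by (simp add: assms is_presheaf_subset[OF _ assms(1)] restrict_presheaf_morphism)
    (use assms(1) in \<open>auto simp: restrict_def fun_eq_iff\<close>)

text \<open>This is the universal property of a right Kan extension, so the limit condition concerns
  the codomain \<open>G\<close>. The restriction of \<open>\<eta> A x\<close> to \<open>b\<close>
  must be \<open>\<eta> b\<close> at the restriction of \<open>x\<close>, which involves only
  \<open>b\<close> in \<open>K\<close>. These values determine \<open>\<eta> A x\<close>; conversely
  they form a matching family, whose gluing defines it.\<close>

lemma bij_betw_restrict_presheaf_morphisms:
  assumes BK: "B \<subseteq> K" and KP: "K \<subseteq> P"
    and F: "is_presheaf U P F"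
    and G: "is_presheaf U P G" "locally_determined P B G"
  shows "bij_betw (\<lambda>\<eta>. restrict \<eta> K) (presheaf_morphisms P F G) (presheaf_morphisms K F G)"
  unfolding bij_betw_def
proof
  have B: "b \<in> K" "b \<in> P" if "b \<in> B" for b
    using BK KP that by auto
  note eqI = locally_determined_eqI[OF G(2,1), OF order_trans[OF BK KP]]
  show "inj_on (\<lambda>\<eta>. restrict \<eta> K) (presheaf_morphisms P F G)"
  proof
    fix \<eta> \<theta> assume *: "\<eta> \<in> presheaf_morphisms P F G" "\<theta> \<in> presheaf_morphisms P F G"
      and "restrict \<eta> K = restrict \<theta> K"
    then have eq: "\<eta> A = \<theta> A" if "A \<in> K" for A
      by (metis restrict_apply' that)
    show "\<eta> = \<theta>"
    proof (rule presheaf_morphism_eqI[OF *])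
      fix A x assume Ax: "A \<in> P" "x \<in> sections F A"
      show "\<eta> A x = \<theta> A x"
      proof (rule eqI)
        fix b assume b: "b \<in> B" "b \<subseteq> A"
        then show "restr G A b (\<eta> A x) = restr G A b (\<theta> A x)"
          using * Ax B[OF b(1)] presheaf_morphism_natural eq by metis
      qed (use * Ax in \<open>auto intro: presheaf_morphism_in\<close>)
    qed simp
  qed
  have "\<theta> \<in> (\<lambda>\<eta>. restrict \<eta> K) ` presheaf_morphisms P F G" if \<theta>: "\<theta> \<in> presheaf_morphisms K F G" for \<theta>
  proof -
    have "\<exists>y. y \<in> sections G A \<and> (\<forall>b\<in>B. b \<subseteq> A \<longrightarrow> restr G A b y = \<theta> b (restr F A b x))"
      if Ax: "A \<in> P" "x \<in> sections F A" for A x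
    proof (rule locally_determined_glue[OF G(2) Ax(1), of "\<lambda>b. \<theta> b (restr F A b x)"])
      fix b c assume bc: "b \<in> B" "c \<in> B" "b \<subseteq> A" "c \<subseteq> b"
      have "restr G b c (\<theta> b (restr F A b x)) = \<theta> c (restr F b c (restr F A b x))"
        using bc Ax B by (intro presheaf_morphism_natural[OF \<theta>, symmetric]) (auto intro: restr_in[OF F])
      also have "restr F b c (restr F A b x) = restr F A c x"
        using bc Ax B by (intro restr_restr[OF F])
      finally show "restr G b c (\<theta> b (restr F A b x)) = \<theta> c (restr F A c x)" .
    qed (use Ax B in \<open>auto intro!: presheaf_morphism_in[OF \<theta>] restr_in[OF F]\<close>)
    then obtain h where h: "\<And>A x. A \<in> P \<Longrightarrow> x \<in> sections F A \<Longrightarrow> h A x \<in> sections G A"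
      "\<And>A x b. A \<in> P \<Longrightarrow> x \<in> sections F A \<Longrightarrow> b \<in> B \<Longrightarrow> b \<subseteq> A \<Longrightarrow>
        restr G A b (h A x) = \<theta> b (restr F A b x)"
      by metis
    define \<eta> where "\<eta> = (\<lambda>A\<in>P. \<lambda>x\<in>sections F A. h A x)"
    have \<eta>: "\<eta> \<in> presheaf_morphisms P F G"
      unfolding \<eta>_def
    proof (rule presheaf_morphismI)
      fix A A' x assume A: "A \<in> P" "A' \<in> P" "A' \<subseteq> A" "x \<in> sections F A"
      have x': "restr F A A' x \<in> sections F A'"
        using A by (intro restr_in[OF F])
      moreover have "h A' (restr F A A' x) = restr G A A' (h A x)"
      proof (rule eqI)
        fix b assume b: "b \<in> B" "b \<subseteq> A'"
        show "restr G A' b (h A' (restr F A A' x)) = restr G A' b (restr G A A' (h A x))"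
          using A b B x' h by (simp add: restr_restr[OF F] restr_restr[OF G(1)] order_trans[OF b(2)])
      qed (use A x' h in \<open>auto intro: restr_in[OF G(1)]\<close>)
      ultimately show "restr F A A' x \<in> sections F A' \<and> h A' (restr F A A' x) = restr G A A' (h A x)" ..
    qed (use h in auto)
    have "restrict \<eta> K = \<theta>"
    proof (rule presheaf_morphism_eqI[OF restrict_presheaf_morphism[OF \<eta> KP] \<theta>])
      fix A x assume A: "A \<in> K" "x \<in> sections F A"
      then have AP: "A \<in> P"
        using KP by auto
      have "h A x = \<theta> A x"
      proof (rule eqI)
        fix b assume b: "b \<in> B" "b \<subseteq> A"
        then show "restr G A b (h A x) = restr G A b (\<theta> A x)"
          using A AP B by (simp add: h presheaf_morphism_natural[OF \<theta>])
      qed (use A AP h in \<open>auto intro: presheaf_morphism_in[OF \<theta>]\<close>)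
      then show "restrict \<eta> K A x = \<theta> A x"
        using A AP by (simp add: \<eta>_def)
    qed simp
    then show ?thesis
      using \<eta> by blast
  qed
  then show "(\<lambda>\<eta>. restrict \<eta> K) ` presheaf_morphisms P F G = presheaf_morphisms K F G"
    using restrict_presheaf_morphism[OF _ KP] by blast
qed

section \<open>Essential surjectivity: extending a presheaf from \<open>K\<close> to
  \<open>P\<close>\<close>

lemma set_universe_PiE:
  assumes U: "set_universe U" and "finite I" "\<And>i. i \<in> I \<Longrightarrow> S i \<in> U"
  shows "\<exists>C\<in>U. (\<Pi>\<^sub>E i\<in>I. S i) \<lesssim> C"
  using assms(2,3)
proof (induction I)
  case empty
  \<comment> \<open>The empty product has one element, so a nonempty member of \<open>U\<close> is
    needed to bound it.\<close>
  obtain A a where "A \<in> U" "a \<in> A"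
    using U unfolding set_universe_def by blast
  then show ?case
    by (auto intro!: bexI[of _ A] simp: lepoll_def)
next
  case (insert i I)
  then obtain C where C: "C \<in> U" "Pi\<^sub>E I S \<lesssim> C"
    by auto
  then obtain C' where C': "C' \<in> U" "S i \<times> C \<lesssim> C'"
    using U insert.prems[of i] unfolding set_universe_def by blast
  have "Pi\<^sub>E (insert i I) S \<lesssim> S i \<times> Pi\<^sub>E I S"
    unfolding PiE_insert_eq by (rule image_lepoll)
  also have "\<dots> \<lesssim> S i \<times> C"
    using C(2) by (intro times_lepoll_mono) auto
  also note C'(2)
  finally show ?case
    using C'(1) by blast
qed

text \<open>The values of \<open>G\<close> on \<open>P\<close> outside \<open>K\<close> are
  arbitrary, so \<open>G\<close> itself cannot serve. The extension is rebuilt on all of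
  \<open>P\<close>, and over \<open>K\<close> it agrees with \<open>G\<close> only up to the
  isomorphism sending a section to the family of its restrictions.\<close>

lemma extend_presheaf:
  fixes U :: "'v set set" and G :: "('a, 'v) presheaf"
  assumes U: "set_universe U" and fin: "finite B" and BK: "B \<subseteq> K" and KP: "K \<subseteq> P"
    and G: "is_presheaf U K G" "locally_determined K B G"
  shows "\<exists>F. is_presheaf U P F \<and> locally_determined P B F \<and> (\<exists>\<eta>. is_iso (presheaf_category U K Q) G F \<eta>)"
proof -
  \<comment> \<open>The extension takes the value \<open>M A\<close> at \<open>A\<close>, up to an encoding by elements of \<open>'v\<close>, which exists
    because \<open>U\<close> is closed under finite products.\<close>
  define M where "M A = {s \<in> (\<Pi>\<^sub>E b\<in>B \<inter> Pow A. sections G b).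
    \<forall>b\<in>B \<inter> Pow A. \<forall>c\<in>B \<inter> Pow b. restr G b c (s b) = s c}" for A
  have BK': "b \<in> K" if "b \<in> B" for b
    using that BK by auto
  have M_restrict: "restrict s (B \<inter> Pow A') \<in> M A'" if "s \<in> M A" "A' \<subseteq> A" for s A A'
  proof -
    have "b \<in> B \<inter> Pow A" if "b \<in> B \<inter> Pow A'" for b
      using that \<open>A' \<subseteq> A\<close> by auto
    then show ?thesis
      using that(1) unfolding M_def by (auto simp: PiE_iff)
  qed
  have restr_M: "(\<lambda>b\<in>B \<inter> Pow A. restr G A b x) \<in> M A" if "A \<in> K" "x \<in> sections G A" for A x
    using that BK' unfolding M_def
    by (auto simp: restr_in[OF G(1)] restr_restr[OF G(1)] subset_trans)
  have "\<exists>code :: _ \<Rightarrow> 'v. inj_on code (M A) \<and> code ` M A \<in> U" for A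
  proof -
    obtain C where C: "C \<in> U" "(\<Pi>\<^sub>E b\<in>B \<inter> Pow A. sections G b) \<lesssim> C"
      using set_universe_PiE[OF U, of "B \<inter> Pow A" "sections G"] fin BK' G(1)
      by (auto simp: is_presheaf_def)
    then obtain f where f: "inj_on f (\<Pi>\<^sub>E b\<in>B \<inter> Pow A. sections G b)" "f ` (\<Pi>\<^sub>E b\<in>B \<inter> Pow A. sections G b) \<subseteq> C"
      unfolding lepoll_def by blast
    have "M A \<subseteq> (\<Pi>\<^sub>E b\<in>B \<inter> Pow A. sections G b)"
      unfolding M_def by blast
    then have "inj_on f (M A)" "f ` M A \<subseteq> C"
      using f by (blast intro: inj_on_subset)+
    moreover have "f ` M A \<in> U"
      using U C(1) subset_imp_lepoll[OF \<open>f ` M A \<subseteq> C\<close>] unfolding set_universe_def by blast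
    ultimately show ?thesis by blast
  qed
  then obtain code :: "'a set \<Rightarrow> ('a set \<Rightarrow> 'v) \<Rightarrow> 'v"
    where inj: "\<And>A. inj_on (code A) (M A)" and codeU: "\<And>A. code A ` M A \<in> U"
    by metis
  define decode where "decode A = inv_into (M A) (code A)" for A
  have decode: "decode A (code A s) = s" if "s \<in> M A" for A s
    unfolding decode_def using inj that by simp
  \<comment> \<open>Restriction decodes a section to a matching family, forgets the components not
    below \<open>A'\<close>, and encodes the rest again.\<close>
  define F where "F = \<lparr>sections = \<lambda>A. code A ` M A,
    restr = \<lambda>A A' v. code A' (restrict (decode A v) (B \<inter> Pow A'))\<rparr>"
  have F_sections: "sections F A = code A ` M A" for A
    by (simp add: F_def)
  have F_restr: "restr F A A' (code A s) = code A' (restrict s (B \<inter> Pow A'))" if "s \<in> M A" for A A' s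
    using that by (simp add: F_def decode)
  have code_eq: "code A s = code A t \<longleftrightarrow> s = t" if "s \<in> M A" "t \<in> M A" for A s t
    using inj that by (auto simp: inj_on_def)
  have F: "is_presheaf U P F"
    unfolding is_presheaf_def F_sections
  proof (intro conjI ballI impI)
    fix A x assume "x \<in> code A ` M A"
    then obtain s where s: "x = code A s" "s \<in> M A" by blast
    moreover have "restrict s (B \<inter> Pow A) = s"
      using s(2) unfolding M_def by (auto intro: extensional_restrict)
    ultimately show "restr F A A x = x"
      by (simp add: F_restr)
  next
    fix A A' A'' x assume "A'' \<subseteq> A' \<and> A' \<subseteq> A" "x \<in> code A ` M A"
    moreover then have "B \<inter> Pow A' \<inter> (B \<inter> Pow A'') = B \<inter> Pow A''" by auto
    ultimately show "restr F A' A'' (restr F A A' x) = restr F A A'' x"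
      by (auto simp: F_restr M_restrict)
  qed (auto simp: codeU F_restr M_restrict)
  have "locally_determined P B F"
  proof (rule locally_determinedI)
    fix A x y assume xy: "x \<in> sections F A" "y \<in> sections F A"
      and eq: "\<And>b. b \<in> B \<Longrightarrow> b \<subseteq> A \<Longrightarrow> restr F A b x = restr F A b y"
    obtain s t where st: "x = code A s" "s \<in> M A" "y = code A t" "t \<in> M A"
      using xy by (auto simp: F_sections)
    have "s b = t b" if b: "b \<in> B \<inter> Pow A" for b
    proof -
      have "restrict s (B \<inter> Pow b) = restrict t (B \<inter> Pow b)"
        using eq[of b] b st by (simp add: F_restr code_eq M_restrict)
      from fun_cong[OF this, of b] show ?thesis
        using b by simp
    qed
    moreover have "s \<in> extensional (B \<inter> Pow A)" "t \<in> extensional (B \<inter> Pow A)"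
      using st(2,4) unfolding M_def by (auto simp: PiE_def)
    ultimately have "s = t"
      by (intro extensionalityI)
    then show "x = y"
      using st by simp
  next
    fix A v assume v: "\<And>b. b \<in> B \<Longrightarrow> b \<subseteq> A \<Longrightarrow> v b \<in> sections F b"
      and match: "\<And>b c. b \<in> B \<Longrightarrow> c \<in> B \<Longrightarrow> b \<subseteq> A \<Longrightarrow> c \<subseteq> b \<Longrightarrow> restr F b c (v b) = v c"
    have "\<exists>t\<in>M b. v b = code b t" if "b \<in> B" "b \<subseteq> A" for b
      using v[OF that] by (auto simp: F_sections)
    then obtain t where t: "\<And>b. b \<in> B \<Longrightarrow> b \<subseteq> A \<Longrightarrow> t b \<in> M b"
      "\<And>b. b \<in> B \<Longrightarrow> b \<subseteq> A \<Longrightarrow> v b = code b (t b)"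
      by metis
    have tt: "t c = restrict (t b) (B \<inter> Pow c)" if "b \<in> B" "c \<in> B" "b \<subseteq> A" "c \<subseteq> b" for b c
      using match[OF that] that t[of b] t[of c] by (simp add: F_restr code_eq M_restrict)
    \<comment> \<open>Each \<open>t b\<close> is itself a matching family indexed by the members of
      \<open>B\<close> below \<open>b\<close>. Its component at \<open>b\<close> carries all the
      information, so the glued family is the diagonal.\<close>
    define s where "s = (\<lambda>b\<in>B \<inter> Pow A. t b b)"
    have sM: "s \<in> M A"
      unfolding M_def
    proof (intro CollectI conjI ballI)
      show "s \<in> (\<Pi>\<^sub>E b\<in>B \<inter> Pow A. sections G b)"
        unfolding s_def restrict_PiE_iff using t(1) by (auto simp: M_def PiE_iff)
      fix b c assume bc: "b \<in> B \<inter> Pow A" "c \<in> B \<inter> Pow b"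
      then have "restr G b c (t b b) = t b c"
        using t(1)[of b] by (simp add: M_def)
      then show "restr G b c (s b) = s c"
        using bc tt[of b c] by (auto simp: s_def)
    qed
    have "restr F A b (code A s) = v b" if b: "b \<in> B" "b \<subseteq> A" for b
    proof -
      have "restrict s (B \<inter> Pow b) = t b"
      proof (rule extensionalityI)
        show "t b \<in> extensional (B \<inter> Pow b)"
          using t(1)[OF b] by (auto simp: M_def PiE_def)
        fix c assume c: "c \<in> B \<inter> Pow b"
        then show "restrict s (B \<inter> Pow b) c = t b c"
          using b tt[of b c] by (auto simp: s_def)
      qed simp
      then show ?thesis
        using sM t(2)[OF b] by (simp add: F_restr)
    qed
    then show "\<exists>x\<in>sections F A. \<forall>b\<in>B. b \<subseteq> A \<longrightarrow> restr F A b x = v b"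
      using sM by (auto simp: F_sections)
  qed
  moreover
  define \<eta> where "\<eta> = (\<lambda>A\<in>K. \<lambda>x\<in>sections G A. code A (\<lambda>b\<in>B \<inter> Pow A. restr G A b x))"
  have "is_iso (presheaf_category U K Q) G F \<eta>"
  proof (rule is_iso_presheaf_category[OF G(1) is_presheaf_subset[OF F KP]])
    show "\<eta> \<in> presheaf_morphisms K G F"
      unfolding \<eta>_def
    proof (rule presheaf_morphismI)
      fix A A' x assume A: "A \<in> K" "A' \<in> K" "A' \<subseteq> A" "x \<in> sections G A"
      have "(\<lambda>b\<in>B \<inter> Pow A'. restr G A' b (restr G A A' x)) = (\<lambda>b\<in>B \<inter> Pow A'. restr G A b x)"
        using A BK' by (intro restrict_ext) (auto simp: restr_restr[OF G(1)])
      moreover have "B \<inter> Pow A \<inter> (B \<inter> Pow A') = B \<inter> Pow A'"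
        using A by auto
      ultimately show "restr G A A' x \<in> sections G A' \<and>
        code A' (\<lambda>b\<in>B \<inter> Pow A'. restr G A' b (restr G A A' x)) =
        restr F A A' (code A (\<lambda>b\<in>B \<inter> Pow A. restr G A b x))"
        using A by (simp add: F_restr restr_M restr_in[OF G(1)])
    qed (simp add: F_sections restr_M)
    fix A assume A: "A \<in> K"
    show "bij_betw (\<eta> A) (sections G A) (sections F A)"
      unfolding bij_betw_def
    proof
      show "inj_on (\<eta> A) (sections G A)"
      proof
        fix x y assume xy: "x \<in> sections G A" "y \<in> sections G A" "\<eta> A x = \<eta> A y"
        then have eq: "(\<lambda>b\<in>B \<inter> Pow A. restr G A b x) = (\<lambda>b\<in>B \<inter> Pow A. restr G A b y)"
          using A by (simp add: \<eta>_def code_eq restr_M)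
        show "x = y"
        proof (rule locally_determined_eqI[OF G(2,1) BK A xy(1,2)])
          fix b assume "b \<in> B" "b \<subseteq> A"
          then show "restr G A b x = restr G A b y"
            using fun_cong[OF eq, of b] by simp
        qed
      qed
      have "s \<in> (\<lambda>x. \<lambda>b\<in>B \<inter> Pow A. restr G A b x) ` sections G A" if s: "s \<in> M A" for s
      proof -
        obtain x where x: "x \<in> sections G A" "\<And>b. b \<in> B \<Longrightarrow> b \<subseteq> A \<Longrightarrow> restr G A b x = s b"
          by (rule locally_determined_glue[OF G(2) A, of s]) (use s in \<open>auto simp: M_def\<close>)
        moreover have "s = (\<lambda>b\<in>B \<inter> Pow A. restr G A b x)"
          by (rule extensionalityI[of _ "B \<inter> Pow A"]) (use s x in \<open>auto simp: M_def PiE_def\<close>)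
        ultimately show ?thesis by blast
      qed
      then show "\<eta> A ` sections G A = sections F A"
        using A restr_M[OF A] by (auto simp: \<eta>_def F_sections)
    qed
  qed
  ultimately show ?thesis
    using F by blast
qed

text \<open>A statement about families ordered by inclusion: topology and connectivity enter only
  when their sheaf conditions are identified with \<open>locally_determined\<close>.\<close>

lemma equivalent_categories_locally_determined:
  assumes "set_universe U" "finite B" "B \<subseteq> K" "K \<subseteq> P"
  shows "equivalent_categories (presheaf_category U P (locally_determined P B))
    (presheaf_category U K (locally_determined K B))"
proof (rule equivalent_categories_if_fully_faithful_essentially_surjective)
  show "is_functor (presheaf_category U P (locally_determined P B))
    (presheaf_category U K (locally_determined K B)) (restriction_functor K)"
    by (rule is_functor_restriction[OF assms(4) locally_determined_subset[OF _ assms(4)]])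
next
  fix G assume "G \<in> obj (presheaf_category U K (locally_determined K B))"
  then have G: "is_presheaf U K G" "locally_determined K B G"
    by (simp_all add: presheaf_category_def)
  obtain F \<eta> where F: "is_presheaf U P F" "locally_determined P B F"
      and "is_iso (presheaf_category U K (locally_determined K B)) G F \<eta>"
    using extend_presheaf[OF assms G] by blast
  then obtain \<theta> where "is_iso (presheaf_category U K (locally_determined K B)) F G \<theta>"
    unfolding is_iso_def by blast
  then show "\<exists>F\<in>obj (presheaf_category U P (locally_determined P B)).
      \<exists>e. is_iso (presheaf_category U K (locally_determined K B)) (fobj (restriction_functor K) F) G e"
    using F by (auto simp: presheaf_category_def restriction_functor_def)
next
  fix F G assume "F \<in> obj (presheaf_category U P (locally_determined P B))"
    "G \<in> obj (presheaf_category U P (locally_determined P B))"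
  then have "bij_betw (\<lambda>\<eta>. restrict \<eta> K) (presheaf_morphisms P F G) (presheaf_morphisms K F G)"
    by (intro bij_betw_restrict_presheaf_morphisms[OF assms(3,4), where U = U]) (simp_all add: presheaf_category_def)
  then show "bij_betw (farr (restriction_functor K) F G)
      (arr (presheaf_category U P (locally_determined P B)) F G)
      (arr (presheaf_category U K (locally_determined K B))
        (fobj (restriction_functor K) F) (fobj (restriction_functor K) G))"
    by (simp add: presheaf_category_def restriction_functor_def)
qed (rule is_category_presheaf_category)+

text \<open>An equality of categories, so that a sheaf condition can be exchanged by rewriting
  inside \<open>equivalent_categories\<close>.\<close>

lemma presheaf_category_cong:
  assumes "\<And>F. is_presheaf U P F \<Longrightarrow> Q F \<longleftrightarrow> Q' F"
  shows "presheaf_category U P Q = presheaf_category U P Q'"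
  unfolding presheaf_category_def using assms by auto

section \<open>Connectivity structures and covering sieves\<close>

lemma connectivity_space_Pow: "Y \<subseteq> X \<Longrightarrow> connectivity_space X (Pow Y)"
  by (auto simp: connectivity_space_def subset_iff)

lemma connectivity_space_subset: "connectivity_space X K \<Longrightarrow> K \<subseteq> Pow X"
  by (simp add: connectivity_space_def)

lemma connectivity_space_empty: "connectivity_space X K \<Longrightarrow> {} \<in> K"
  by (simp add: connectivity_space_def)

lemma connectivity_space_Union:
  "connectivity_space X K \<Longrightarrow> \<A> \<subseteq> K \<Longrightarrow> \<Inter>\<A> \<noteq> {} \<Longrightarrow> \<Union>\<A> \<in> K"
  by (simp add: connectivity_space_def)

lemma generated_connectivity_least:
  "connectivity_space X K \<Longrightarrow> \<A> \<subseteq> K \<Longrightarrow> generated_connectivity X \<A> \<subseteq> K"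
  unfolding generated_connectivity_def by (rule Inter_lower) simp

lemma subset_generated_connectivity: "\<A> \<subseteq> generated_connectivity X \<A>"
  unfolding generated_connectivity_def by (rule Inter_greatest) simp

lemma generated_connectivity_mono:
  "\<A> \<subseteq> \<B> \<Longrightarrow> generated_connectivity X \<A> \<subseteq> generated_connectivity X \<B>"
  unfolding generated_connectivity_def by (rule Inter_anti_mono) auto

text \<open>The hypothesis makes \<open>Pow X\<close> one of the intersected structures; for other
  \<open>\<A>\<close> the intersection is over the empty family and yields
  \<open>UNIV\<close>.\<close>

lemma connectivity_space_generated:
  assumes "\<A> \<subseteq> Pow X"
  shows "connectivity_space X (generated_connectivity X \<A>)"
  unfolding connectivity_space_def
proof (intro conjI allI impI)
  show "generated_connectivity X \<A> \<subseteq> Pow X"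
    by (rule generated_connectivity_least[OF connectivity_space_Pow assms]) simp
  show "{} \<in> generated_connectivity X \<A>"
    by (auto simp: generated_connectivity_def intro: connectivity_space_empty)
  fix \<B> assume \<B>: "\<B> \<subseteq> generated_connectivity X \<A> \<and> \<Inter>\<B> \<noteq> {}"
  show "\<Union>\<B> \<in> generated_connectivity X \<A>"
    unfolding generated_connectivity_def
  proof (rule InterI, clarify)
    fix K assume K: "connectivity_space X K" "\<A> \<subseteq> K"
    then have "\<B> \<subseteq> K"
      using \<B> subset_trans[OF _ generated_connectivity_least[OF K]] by simp
    then show "\<Union>\<B> \<in> K"
      using K(1) \<B> by (simp add: connectivity_space_Union)
  qed
qed

text \<open>The sets \<open>C\<close> with this property form a connectivity structure containing
  \<open>B\<close>: if each member of a family is generated by the elements of \<open>B\<close>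
  inside it, all members are generated by the elements of \<open>B\<close> inside the union, and
  hence so is the union.\<close>

lemma generated_connectivity_local:
  assumes B: "B \<subseteq> Pow X" and C: "C \<in> generated_connectivity X B"
  shows "C \<in> generated_connectivity X (B \<inter> Pow C)"
proof -
  have conn: "connectivity_space X (generated_connectivity X (B \<inter> Pow C))" for C
    using B by (intro connectivity_space_generated) auto
  let ?L = "{C. C \<in> generated_connectivity X (B \<inter> Pow C)}"
  have "connectivity_space X ?L"
    unfolding connectivity_space_def
  proof (intro conjI allI impI)
    show "?L \<subseteq> Pow X"
    proof
      fix C assume "C \<in> ?L"
      then show "C \<in> Pow X"
        using connectivity_space_subset[OF conn, of C] by (simp add: subset_iff)
    qed
    show "{} \<in> ?L"
      using connectivity_space_empty[OF conn, of "{}"] by simp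
    fix \<A> assume \<A>: "\<A> \<subseteq> ?L \<and> \<Inter>\<A> \<noteq> {}"
    have "\<A> \<subseteq> generated_connectivity X (B \<inter> Pow (\<Union>\<A>))"
    proof
      fix A assume A: "A \<in> \<A>"
      then have "B \<inter> Pow A \<subseteq> B \<inter> Pow (\<Union>\<A>)"
        by auto
      moreover have "A \<in> generated_connectivity X (B \<inter> Pow A)"
        using A \<A> by auto
      ultimately show "A \<in> generated_connectivity X (B \<inter> Pow (\<Union>\<A>))"
        by (rule subsetD[OF generated_connectivity_mono])
    qed
    then show "\<Union>\<A> \<in> ?L"
      using connectivity_space_Union[OF conn] \<A> by simp
  qed
  moreover have "B \<subseteq> ?L"
  proof
    fix b assume "b \<in> B"
    then show "b \<in> ?L"
      by (simp add: subsetD[OF subset_generated_connectivity])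
  qed
  ultimately have "generated_connectivity X B \<subseteq> ?L"
    by (rule generated_connectivity_least)
  then show ?thesis
    using C by auto
qed

lemma connectivity_space_down:
  assumes K: "connectivity_space X K"
  shows "connectivity_space X (K \<inter> Pow A)"
  unfolding connectivity_space_def
proof (intro conjI allI impI)
  show "K \<inter> Pow A \<subseteq> Pow X"
    using connectivity_space_subset[OF K] by auto
  show "{} \<in> K \<inter> Pow A"
    using connectivity_space_empty[OF K] by simp
  fix \<A> assume \<A>: "\<A> \<subseteq> K \<inter> Pow A \<and> \<Inter>\<A> \<noteq> {}"
  then have "\<Union>\<A> \<in> K"
    by (intro connectivity_space_Union[OF K]) auto
  moreover have "\<Union>\<A> \<subseteq> A"
    using \<A> by auto
  ultimately show "\<Union>\<A> \<in> K \<inter> Pow A"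
    by simp
qed

text \<open>For the converse direction, a set \<open>C\<close> in \<open>K\<close> below
  \<open>A\<close> is generated by the members of \<open>B\<close> inside \<open>C\<close>, and
  these lie in \<open>\<sigma>\<close>. Irreducibility is asked for subfamilies of the generated
  structure because sieves are such families.\<close>

lemma mem_covering_sieves_iff:
  assumes B: "B \<subseteq> Pow X" and A: "A \<in> generated_connectivity X B"
    and irred: "\<And>b \<W>. b \<in> B \<Longrightarrow> \<W> \<subseteq> generated_connectivity X B \<Longrightarrow> b \<subseteq> \<Union>\<W> \<Longrightarrow> \<exists>W\<in>\<W>. b \<subseteq> W"
  defines "K \<equiv> generated_connectivity X B"
  shows "\<sigma> \<in> covering_sieves X K A \<longleftrightarrow> is_sieve K A \<sigma> \<and> B \<inter> Pow A \<subseteq> \<sigma>"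
proof
  have K: "connectivity_space X K"
    unfolding K_def by (rule connectivity_space_generated[OF B])
  have BK: "B \<subseteq> K"
    unfolding K_def by (rule subset_generated_connectivity)
  { assume "\<sigma> \<in> covering_sieves X K A"
    then have \<sigma>: "is_sieve K A \<sigma>" "generated_connectivity X \<sigma> = K \<inter> Pow A"
      by (auto simp: covering_sieves_def)
    have \<sigma>K: "\<sigma> \<subseteq> K"
      using \<sigma>(1) by (auto simp: is_sieve_def)
    \<comment> \<open>All subsets of \<open>\<Union>\<sigma>\<close> form a connectivity structure, so \<open>\<sigma>\<close> generates nothing outside it.\<close>
    have "connectivity_space X (Pow (\<Union>\<sigma>))"
      using \<sigma>K K by (intro connectivity_space_Pow) (auto simp: connectivity_space_def)
    then have "generated_connectivity X \<sigma> \<subseteq> Pow (\<Union>\<sigma>)"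
      by (rule generated_connectivity_least) auto
    then have A\<sigma>: "A \<subseteq> \<Union>\<sigma>"
      using \<sigma>(2) A unfolding K_def by blast
    have "b \<in> \<sigma>" if b: "b \<in> B" "b \<subseteq> A" for b
    proof -
      obtain W where "W \<in> \<sigma>" "b \<subseteq> W"
        using irred[of b \<sigma>] b A\<sigma> \<sigma>K unfolding K_def by blast
      then show ?thesis
        using \<sigma>(1) BK b unfolding is_sieve_def by blast
    qed
    then show "is_sieve K A \<sigma> \<and> B \<inter> Pow A \<subseteq> \<sigma>"
      using \<sigma>(1) by blast }
  { assume \<sigma>: "is_sieve K A \<sigma> \<and> B \<inter> Pow A \<subseteq> \<sigma>"
    have "generated_connectivity X \<sigma> \<subseteq> K \<inter> Pow A"
      using \<sigma> by (intro generated_connectivity_least connectivity_space_down K) (auto simp: is_sieve_def)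
    moreover have "C \<in> generated_connectivity X \<sigma>" if C: "C \<in> K" "C \<subseteq> A" for C
    proof -
      have "B \<inter> Pow C \<subseteq> \<sigma>"
        using \<sigma> C(2) by blast
      moreover have "C \<in> generated_connectivity X (B \<inter> Pow C)"
        using generated_connectivity_local[OF B] C(1) unfolding K_def .
      ultimately show ?thesis
        by (rule subsetD[OF generated_connectivity_mono])
    qed
    ultimately show "\<sigma> \<in> covering_sieves X K A"
      using \<sigma> by (auto simp: covering_sieves_def) }
qed

section \<open>Sheaves as locally determined presheaves\<close>

text \<open>From sheaf to limit, the sheaf condition acts at two levels: separation at every
  \<open>C\<close> in \<open>K\<close> makes the extension of a matching family from
  \<open>B\<close> to a sieve well defined, and then gluing applies at \<open>A\<close>. In the
  other direction, sections over the members of a covering sieve are compared on the elements of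
  \<open>B\<close> below them.\<close>

lemma site_sheaf_iff_locally_determined:
  assumes F: "is_presheaf U K F" and BK: "B \<subseteq> K"
    and J: "\<And>A \<sigma>. A \<in> K \<Longrightarrow> \<sigma> \<in> J A \<longleftrightarrow> is_sieve K A \<sigma> \<and> B \<inter> Pow A \<subseteq> \<sigma>"
  shows "site_sheaf K J F \<longleftrightarrow> locally_determined K B F"
proof
  have BK': "b \<in> K" if "b \<in> B" for b
    using that BK by auto
  { assume sheaf: "site_sheaf K J F"
    \<comment> \<open>The sieve generated by the members of \<open>B\<close> below \<open>A\<close>,
      hence the smallest covering sieve of \<open>A\<close>.\<close>
    define \<sigma> where "\<sigma> A = {C \<in> K. \<exists>b\<in>B. C \<subseteq> b \<and> b \<subseteq> A}" for A
    have \<sigma>: "\<sigma> A \<in> J A" if "A \<in> K" for A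
      using that BK unfolding J[OF that] is_sieve_def \<sigma>_def by blast
    have sep: "x = y" if A: "A \<in> K" "x \<in> sections F A" "y \<in> sections F A"
      and eq: "\<And>b. b \<in> B \<Longrightarrow> b \<subseteq> A \<Longrightarrow> restr F A b x = restr F A b y" for A x y
    proof -
      have 1: "(\<lambda>C. restr F A C x) \<in> (\<Pi> C\<in>\<sigma> A. sections F C)"
        using A by (auto simp: \<sigma>_def intro!: restr_in[OF F])
      have 2: "\<forall>C\<in>\<sigma> A. \<forall>D\<in>K. D \<subseteq> C \<longrightarrow> restr F C D (restr F A C x) = restr F A D x"
        using A by (auto simp: \<sigma>_def intro!: restr_restr[OF F])
      have "restr F A C y = restr F A C x" if C: "C \<in> \<sigma> A" for C
      proof -
        obtain b where b: "b \<in> B" "C \<subseteq> b" "b \<subseteq> A" "C \<in> K"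
          using C by (auto simp: \<sigma>_def)
        then show ?thesis
          using A eq[of b] BK' restr_restr[OF F _ b(3,2)] by metis
      qed
      moreover have "\<exists>!z. z \<in> sections F A \<and> (\<forall>C\<in>\<sigma> A. restr F A C z = restr F A C x)"
        by (rule mp[OF bspec[OF bspec[OF bspec[OF sheaf[unfolded site_sheaf_def] A(1)] \<sigma>[OF A(1)]] 1] 2])
      ultimately show ?thesis
        using A by metis
    qed
    show "locally_determined K B F"
    proof (rule locally_determinedI)
      fix A s assume A: "A \<in> K"
        and s: "\<And>b. b \<in> B \<Longrightarrow> b \<subseteq> A \<Longrightarrow> s b \<in> sections F b"
        and match: "\<And>b c. b \<in> B \<Longrightarrow> c \<in> B \<Longrightarrow> b \<subseteq> A \<Longrightarrow> c \<subseteq> b \<Longrightarrow> restr F b c (s b) = s c"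
      have "\<forall>C. \<exists>b. C \<in> \<sigma> A \<longrightarrow> b \<in> B \<and> C \<subseteq> b \<and> b \<subseteq> A"
        by (auto simp: \<sigma>_def)
      then obtain p where p: "\<And>C. C \<in> \<sigma> A \<Longrightarrow> p C \<in> B" "\<And>C. C \<in> \<sigma> A \<Longrightarrow> C \<subseteq> p C" "\<And>C. C \<in> \<sigma> A \<Longrightarrow> p C \<subseteq> A"
        by metis
      \<comment> \<open>A set \<open>C\<close> in the sieve may lie below several members of
        \<open>B\<close>; \<open>p C\<close> is an arbitrary choice of one.\<close>
      define t where "t C = restr F (p C) C (s (p C))" for C
      have \<sigma>K: "C \<in> K" if "C \<in> \<sigma> A" for C
        using that by (simp add: \<sigma>_def)
      have t: "t C \<in> sections F C" if "C \<in> \<sigma> A" for C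
        unfolding t_def using that by (intro restr_in[OF F] s p) (simp_all add: BK' \<sigma>K p)
      \<comment> \<open>Independence of the choice. There may be no member of \<open>B\<close>
        between \<open>C\<close> and both \<open>b\<close> and \<open>p C\<close>, so the two
        candidates are compared on the members of \<open>B\<close> below \<open>C\<close> and
        identified by separation at \<open>C\<close>.\<close>
      have t_eq: "t C = restr F b C (s b)" if b: "b \<in> B" "C \<subseteq> b" "b \<subseteq> A" and C: "C \<in> K" for b C
      proof (rule sep[OF C])
        have C\<sigma>: "C \<in> \<sigma> A"
          using b C by (auto simp: \<sigma>_def)
        then show "t C \<in> sections F C"
          by (rule t)
        show "restr F b C (s b) \<in> sections F C"
          using b C by (intro restr_in[OF F] s) (simp_all add: BK')
        fix c assume c: "c \<in> B" "c \<subseteq> C"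
        have "restr F C c (t C) = restr F (p C) c (s (p C))"
          unfolding t_def using p[OF C\<sigma>] c C by (intro restr_restr[OF F] s) (simp_all add: BK')
        also have "\<dots> = s c"
          using p[OF C\<sigma>] c by (intro match) auto
        also have "\<dots> = restr F b c (s b)"
          using b c by (intro match[symmetric]) auto
        also have "\<dots> = restr F C c (restr F b C (s b))"
          using b c C by (intro restr_restr[OF F, symmetric] s) (simp_all add: BK')
        finally show "restr F C c (t C) = restr F C c (restr F b C (s b))" .
      qed
      have 1: "t \<in> (\<Pi> C\<in>\<sigma> A. sections F C)"
        using t by blast
      have 2: "\<forall>C\<in>\<sigma> A. \<forall>D\<in>K. D \<subseteq> C \<longrightarrow> restr F C D (t C) = t D"
      proof (intro ballI impI)
        fix C D assume C: "C \<in> \<sigma> A" and D: "D \<in> K" "D \<subseteq> C"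
        have "restr F C D (t C) = restr F (p C) D (s (p C))"
          unfolding t_def using p[OF C] C D by (intro restr_restr[OF F] s) (simp_all add: BK' \<sigma>K)
        also have "\<dots> = t D"
          using p[OF C] D by (intro t_eq[symmetric]) auto
        finally show "restr F C D (t C) = t D" .
      qed
      have "\<exists>!x. x \<in> sections F A \<and> (\<forall>C\<in>\<sigma> A. restr F A C x = t C)"
        by (rule mp[OF bspec[OF bspec[OF bspec[OF sheaf[unfolded site_sheaf_def] A] \<sigma>[OF A]] 1] 2])
      then obtain x where x: "x \<in> sections F A" "\<And>C. C \<in> \<sigma> A \<Longrightarrow> restr F A C x = t C"
        by blast
      have "restr F A b x = s b" if b: "b \<in> B" "b \<subseteq> A" for b
      proof -
        have "b \<in> \<sigma> A"
          using b BK' by (auto simp: \<sigma>_def)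
        then show ?thesis
          using x(2) t_eq[OF b(1) order_refl b(2) BK'[OF b(1)]] match[OF b(1) b order_refl] by simp
      qed
      then show "\<exists>x\<in>sections F A. \<forall>b\<in>B. b \<subseteq> A \<longrightarrow> restr F A b x = s b"
        using x(1) by blast
    qed (rule sep) }
  { assume ld: "locally_determined K B F"
    note eqI = locally_determined_eqI[OF ld F BK]
    show "site_sheaf K J F"
      unfolding site_sheaf_def
    proof (intro ballI impI)
      fix A \<sigma> s assume A: "A \<in> K" and \<sigma>: "\<sigma> \<in> J A" and s: "s \<in> (\<Pi> C\<in>\<sigma>. sections F C)"
        and match: "\<forall>C\<in>\<sigma>. \<forall>D\<in>K. D \<subseteq> C \<longrightarrow> restr F C D (s C) = s D"
      have sieve: "is_sieve K A \<sigma>" and B\<sigma>: "\<And>b. b \<in> B \<Longrightarrow> b \<subseteq> A \<Longrightarrow> b \<in> \<sigma>"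
        using \<sigma> unfolding J[OF A] by auto
      have \<sigma>K: "C \<in> K" "C \<subseteq> A" if "C \<in> \<sigma>" for C
        using sieve that by (auto simp: is_sieve_def)
      obtain x where x: "x \<in> sections F A" "\<And>b. b \<in> B \<Longrightarrow> b \<subseteq> A \<Longrightarrow> restr F A b x = s b"
        by (rule locally_determined_glue[OF ld A, of s])
          (simp_all add: Pi_mem[OF s] match B\<sigma> BK')
      have "restr F A C x = s C" if C: "C \<in> \<sigma>" for C
      proof (rule eqI)
        fix b assume b: "b \<in> B" "b \<subseteq> C"
        then have "restr F C b (restr F A C x) = restr F A b x"
          using A \<sigma>K[OF C] by (intro restr_restr[OF F x(1)]) (simp_all add: BK')
        also have "\<dots> = s b"
          using b \<sigma>K(2)[OF C] by (intro x(2)) auto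
        also have "\<dots> = restr F C b (s C)"
          using bspec[OF bspec[OF match C] BK'[OF b(1)]] b(2) by simp
        finally show "restr F C b (restr F A C x) = restr F C b (s C)" .
      next
        show "restr F A C x \<in> sections F C"
          using A \<sigma>K[OF C] by (intro restr_in[OF F x(1)])
        show "s C \<in> sections F C"
          using s C by (rule Pi_mem)
      qed (rule \<sigma>K(1)[OF C])
      moreover have "y = x" if y: "y \<in> sections F A" "\<forall>C\<in>\<sigma>. restr F A C y = s C" for y
      proof (rule eqI[OF A y(1) x(1)])
        fix b assume b: "b \<in> B" "b \<subseteq> A"
        then show "restr F A b y = restr F A b x"
          using bspec[OF y(2) B\<sigma>[OF b]] x(2)[OF b] by simp
      qed
      ultimately show "\<exists>!x. x \<in> sections F A \<and> (\<forall>C\<in>\<sigma>. restr F A C x = s C)"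
        using x(1) by blast
    qed }
qed

text \<open>Topological matching is tested on intersections, which need not belong to
  \<open>B\<close>, while the limit condition tests inclusions inside \<open>B\<close>.
  \<open>basis\<close> passes from inclusions to intersections, and \<open>irred\<close> reduces an
  arbitrary cover to the members of \<open>B\<close>.\<close>

lemma top_sheaf_iff_locally_determined:
  assumes F: "is_presheaf U {W. openin T W} F" and B_open: "\<And>b. b \<in> B \<Longrightarrow> openin T b"
    and basis: "\<And>W. openin T W \<Longrightarrow> \<Union>(B \<inter> Pow W) = W"
    and irred: "\<And>b \<W>. b \<in> B \<Longrightarrow> \<forall>W\<in>\<W>. openin T W \<Longrightarrow> b \<subseteq> \<Union>\<W> \<Longrightarrow> \<exists>W\<in>\<W>. b \<subseteq> W"
  shows "top_sheaf T F \<longleftrightarrow> locally_determined {W. openin T W} B F"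
proof
  have F_in: "restr F A A' x \<in> sections F A'"
    if "x \<in> sections F A" "A' \<subseteq> A" "openin T A" "openin T A'" for A A' x
    using that by (intro restr_in[OF F]) auto
  have F_comp: "restr F A' A'' (restr F A A' x) = restr F A A'' x"
    if "x \<in> sections F A" "A' \<subseteq> A" "A'' \<subseteq> A'" "openin T A" "openin T A'" "openin T A''" for A A' A'' x
    using that by (intro restr_restr[OF F]) auto
  { assume sheaf: "top_sheaf T F"
    \<comment> \<open>The sheaf condition for the cover of \<open>A\<close> by the members of
      \<open>B\<close> below it, whose union is \<open>A\<close> by \<open>basis\<close>.\<close>
    have glue: "\<exists>!x. x \<in> sections F A \<and> (\<forall>b\<in>B \<inter> Pow A. restr F A b x = s b)"
      if A: "openin T A" and "s \<in> (\<Pi> b\<in>B \<inter> Pow A. sections F b)"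
        and "\<forall>b\<in>B \<inter> Pow A. \<forall>c\<in>B \<inter> Pow A. restr F b (b \<inter> c) (s b) = restr F c (b \<inter> c) (s c)" for A s
    proof -
      have "\<forall>b\<in>B \<inter> Pow A. openin T b"
        using B_open by blast
      from bspec[OF mp[OF spec[OF sheaf[unfolded top_sheaf_def]] this] that(2)] that(3)
      show ?thesis
        unfolding basis[OF A] by blast
    qed
    have sep: "x = y" if A: "openin T A" "x \<in> sections F A" "y \<in> sections F A"
      and eq: "\<And>b. b \<in> B \<Longrightarrow> b \<subseteq> A \<Longrightarrow> restr F A b x = restr F A b y" for A x y
    proof -
      have "\<exists>!z. z \<in> sections F A \<and> (\<forall>b\<in>B \<inter> Pow A. restr F A b z = restr F A b x)"
      proof (rule glue[OF A(1)])
        show "\<forall>b\<in>B \<inter> Pow A. \<forall>c\<in>B \<inter> Pow A.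
            restr F b (b \<inter> c) (restr F A b x) = restr F c (b \<inter> c) (restr F A c x)"
          using A B_open by (auto simp: F_comp openin_Int)
      qed (use A B_open F_in in auto)
      then show ?thesis
        using A eq by (metis Int_iff PowD)
    qed
    show "locally_determined {W. openin T W} B F"
    proof (rule locally_determinedI)
      fix A s assume A: "A \<in> {W. openin T W}"
        and s: "\<And>b. b \<in> B \<Longrightarrow> b \<subseteq> A \<Longrightarrow> s b \<in> sections F b"
        and match: "\<And>b c. b \<in> B \<Longrightarrow> c \<in> B \<Longrightarrow> b \<subseteq> A \<Longrightarrow> c \<subseteq> b \<Longrightarrow> restr F b c (s b) = s c"
      have "\<exists>!x. x \<in> sections F A \<and> (\<forall>b\<in>B \<inter> Pow A. restr F A b x = s b)"
      proof (rule glue)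
        show "\<forall>b\<in>B \<inter> Pow A. \<forall>c\<in>B \<inter> Pow A. restr F b (b \<inter> c) (s b) = restr F c (b \<inter> c) (s c)"
        proof (intro ballI)
          fix b c assume bc: "b \<in> B \<inter> Pow A" "c \<in> B \<inter> Pow A"
          then have open_bc: "openin T (b \<inter> c)" "openin T b" "openin T c"
            using B_open by auto
          \<comment> \<open>The open set \<open>b \<inter> c\<close> is covered by members
            \<open>d\<close> of \<open>B\<close>, and on each of them both sides restrict to
            \<open>s d\<close>.\<close>
          show "restr F b (b \<inter> c) (s b) = restr F c (b \<inter> c) (s c)"
          proof (rule sep[OF open_bc(1)])
            fix d assume "d \<in> B" "d \<subseteq> b \<inter> c"
            then show "restr F (b \<inter> c) d (restr F b (b \<inter> c) (s b)) = restr F (b \<inter> c) d (restr F c (b \<inter> c) (s c))"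
              using bc s match B_open open_bc by (simp add: F_comp)
          qed (use bc s open_bc F_in in auto)
        qed
      qed (use A s in auto)
      then show "\<exists>x\<in>sections F A. \<forall>b\<in>B. b \<subseteq> A \<longrightarrow> restr F A b x = s b"
        by blast
    qed (use sep in auto) }
  { assume ld: "locally_determined {W. openin T W} B F"
    have "B \<subseteq> {W. openin T W}"
      using B_open by blast
    note eqI = locally_determined_eqI[OF ld F this, OF CollectI]
    show "top_sheaf T F"
      unfolding top_sheaf_def
    proof (intro allI ballI impI)
      fix \<W> s assume \<W>: "\<forall>W\<in>\<W>. openin T W" and s: "s \<in> (\<Pi> W\<in>\<W>. sections F W)"
        and match: "\<forall>V\<in>\<W>. \<forall>W\<in>\<W>. restr F V (V \<inter> W) (s V) = restr F W (V \<inter> W) (s W)"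
      have union: "openin T (\<Union>\<W>)"
        using \<W> by blast
      have match': "restr F V b (s V) = restr F W b (s W)"
        if "b \<in> B" "V \<in> \<W>" "W \<in> \<W>" "b \<subseteq> V" "b \<subseteq> W" for b V W
      proof -
        have "restr F (V \<inter> W) b (restr F V (V \<inter> W) (s V)) = restr F (V \<inter> W) b (restr F W (V \<inter> W) (s W))"
          by (simp only: bspec[OF bspec[OF match that(2)] that(3)])
        then show ?thesis
          using that \<W> s B_open by (simp add: F_comp openin_Int Pi_iff)
      qed
      \<comment> \<open>Each \<open>b\<close> lies in a single member of the cover, so the required
        value at \<open>b\<close> can be read off there; \<open>match'\<close> shows that the chosen
        member \<open>p b\<close> does not affect it.\<close>
      have "\<forall>b. \<exists>W. b \<in> B \<and> b \<subseteq> \<Union>\<W> \<longrightarrow> W \<in> \<W> \<and> b \<subseteq> W"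
        using irred \<W> by blast
      then obtain p where p: "\<And>b. b \<in> B \<Longrightarrow> b \<subseteq> \<Union>\<W> \<Longrightarrow> p b \<in> \<W>" "\<And>b. b \<in> B \<Longrightarrow> b \<subseteq> \<Union>\<W> \<Longrightarrow> b \<subseteq> p b"
        by metis
      have s_p: "s (p b) \<in> sections F (p b)" "openin T (p b)" if "b \<in> B" "b \<subseteq> \<Union>\<W>" for b
        using s \<W> p[OF that] by auto
      obtain x where x: "x \<in> sections F (\<Union>\<W>)"
        "\<And>b. b \<in> B \<Longrightarrow> b \<subseteq> \<Union>\<W> \<Longrightarrow> restr F (\<Union>\<W>) b x = restr F (p b) b (s (p b))"
      proof (rule locally_determined_glue[OF ld, of "\<Union>\<W>" "\<lambda>b. restr F (p b) b (s (p b))"])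
        fix b c assume bc: "b \<in> B" "c \<in> B" "b \<subseteq> \<Union>\<W>" "c \<subseteq> b"
        then have c: "c \<subseteq> \<Union>\<W>" by blast
        have "restr F b c (restr F (p b) b (s (p b))) = restr F (p b) c (s (p b))"
          using bc p s_p B_open by (intro F_comp) auto
        also have "\<dots> = restr F (p c) c (s (p c))"
          using bc(2) p(1)[OF bc(1,3)] p(1)[OF bc(2) c] order_trans[OF bc(4) p(2)[OF bc(1,3)]] p(2)[OF bc(2) c]
          by (rule match')
        finally show "restr F b c (restr F (p b) b (s (p b))) = restr F (p c) c (s (p c))" .
      qed (use union p s_p B_open F_in in auto)
      have "restr F (\<Union>\<W>) W x = s W" if W: "W \<in> \<W>" for W
      proof (rule eqI)
        show "openin T W" using W \<W> by blast
        fix b assume b: "b \<in> B" "b \<subseteq> W"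
        then have b': "b \<subseteq> \<Union>\<W>" using W by blast
        have "restr F W b (restr F (\<Union>\<W>) W x) = restr F (\<Union>\<W>) b x"
          using x(1) W b \<W> union B_open by (intro F_comp) auto
        also have "\<dots> = restr F W b (s W)"
          unfolding x(2)[OF b(1) b'] by (rule match'[OF b(1) p(1)[OF b(1) b'] W p(2)[OF b(1) b'] b(2)])
        finally show "restr F W b (restr F (\<Union>\<W>) W x) = restr F W b (s W)" .
      qed (use s x(1) W \<W> union in \<open>auto intro!: F_in\<close>)
      moreover have "y = x"
        if y: "y \<in> sections F (\<Union>\<W>)" "\<forall>W\<in>\<W>. restr F (\<Union>\<W>) W y = s W" for y
      proof (rule eqI[OF union y(1) x(1)])
        fix b assume b: "b \<in> B" "b \<subseteq> \<Union>\<W>"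
        have "restr F (\<Union>\<W>) b y = restr F (p b) b (restr F (\<Union>\<W>) (p b) y)"
          using y(1) b p s_p union B_open by (intro F_comp[symmetric]) auto
        then show "restr F (\<Union>\<W>) b y = restr F (\<Union>\<W>) b x"
          using y(2) p(1)[OF b] x(2)[OF b] by simp
      qed
      ultimately show "\<exists>!x. x \<in> sections F (\<Union>\<W>) \<and> (\<forall>W\<in>\<W>. restr F (\<Union>\<W>) W x = s W)"
        using x(1) by blast
    qed }
qed

section \<open>Minimal neighbourhoods\<close>

text \<open>An upper bound for the structure generated by open sets, which puts all of
  \<open>K\<close> inside the topology.\<close>

lemma connectivity_space_openin: "connectivity_space (topspace T) {W. openin T W}"
  unfolding connectivity_space_def by (auto dest: openin_subset)

text \<open>For \<open>x\<close> outside \<open>topspace T\<close> the intersected family is empty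
  and the value is \<open>UNIV\<close>; \<open>mem_min_nbhd\<close> thus holds for every
  \<open>x\<close>, while openness is claimed only for points of the space.\<close>

definition min_nbhd :: "'a topology \<Rightarrow> 'a \<Rightarrow> 'a set" where
  "min_nbhd T x = \<Inter>{W. openin T W \<and> x \<in> W}"

lemma openin_min_nbhd:
  assumes "finite (topspace T)" "x \<in> topspace T"
  shows "openin T (min_nbhd T x)"
  unfolding min_nbhd_def
proof (rule openin_Inter)
  have "{W. openin T W \<and> x \<in> W} \<subseteq> Pow (topspace T)"
    by (auto dest: openin_subset)
  then show "finite {W. openin T W \<and> x \<in> W}"
    using assms(1) by (simp add: finite_subset)
qed (use assms(2) in auto)

lemma mem_min_nbhd: "x \<in> min_nbhd T x"
  by (simp add: min_nbhd_def)

lemma min_nbhd_subset: "openin T W \<Longrightarrow> x \<in> W \<Longrightarrow> min_nbhd T x \<subseteq> W"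
  unfolding min_nbhd_def by blast

theorem mainTheorem2:
  fixes T :: "'a topology"
  assumes "finite (topspace T)"
  shows "\<exists>(X :: 'a set) K. finite X \<and> connectivity_space X K \<and>
    (\<forall>U :: 'v set set. set_universe U \<longrightarrow>
       equivalent_categories (Sh_top U T) (Sh_conn U X K))"
proof -
  define X where "X = topspace T"
  define B where "B = min_nbhd T ` X"
  define K where "K = generated_connectivity X B"
  have B_open: "openin T b" if "b \<in> B" for b
    using that openin_min_nbhd[OF assms] by (auto simp: B_def X_def)
  have BX: "B \<subseteq> Pow X"
    using B_open openin_subset unfolding X_def by blast
  have K: "connectivity_space X K"
    unfolding K_def by (rule connectivity_space_generated[OF BX])
  have BK: "B \<subseteq> K"
    unfolding K_def by (rule subset_generated_connectivity)
  have K_open: "K \<subseteq> {W. openin T W}"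
    unfolding K_def X_def
    by (rule generated_connectivity_least[OF connectivity_space_openin]) (use B_open in auto)
  have basis: "\<Union>(B \<inter> Pow W) = W" if W: "openin T W" for W
  proof
    show "W \<subseteq> \<Union>(B \<inter> Pow W)"
      using min_nbhd_subset[OF W] mem_min_nbhd openin_subset[OF W] unfolding B_def X_def by fast
  qed auto
  \<comment> \<open>The point whose minimal neighbourhood is \<open>b\<close> lies in some
    \<open>W\<close>, and minimality puts all of \<open>b\<close> into that
    \<open>W\<close>.\<close>
  have irred: "\<exists>W\<in>\<W>. b \<subseteq> W" if b: "b \<in> B" and \<W>: "\<forall>W\<in>\<W>. openin T W" "b \<subseteq> \<Union>\<W>" for b \<W>
  proof -
    obtain x where x: "b = min_nbhd T x"
      using b by (auto simp: B_def)
    obtain W where W: "W \<in> \<W>" "x \<in> W"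
      using \<W>(2) mem_min_nbhd[of x T] unfolding x by blast
    then have "b \<subseteq> W"
      unfolding x using \<W>(1) W by (intro min_nbhd_subset) auto
    then show ?thesis
      using W(1) by blast
  qed
  \<comment> \<open>\<open>X\<close> and \<open>K\<close> are fixed before \<open>U\<close>, so one
    connectivity space serves every universe.\<close>
  have "equivalent_categories (Sh_top U T) (Sh_conn U X K)" if U: "set_universe U" for U :: "'v set set"
  proof -
    have "Sh_top U T = presheaf_category U {W. openin T W} (locally_determined {W. openin T W} B)"
      unfolding Sh_top_def
      by (rule presheaf_category_cong[OF top_sheaf_iff_locally_determined[OF _ B_open basis irred]])
    \<comment> \<open>Members of \<open>K\<close> are open, so irreducibility with respect to open
      families covers subfamilies of \<open>K\<close>.\<close>
    moreover have "\<sigma> \<in> covering_sieves X K A \<longleftrightarrow> is_sieve K A \<sigma> \<and> B \<inter> Pow A \<subseteq> \<sigma>" if "A \<in> K" for A \<sigma>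
      using that K_open unfolding K_def
      by (intro mem_covering_sieves_iff[OF BX]) (auto intro!: irred)
    then have "Sh_conn U X K = presheaf_category U K (locally_determined K B)"
      unfolding Sh_conn_def
      by (intro presheaf_category_cong site_sheaf_iff_locally_determined[OF _ BK]) assumption
    moreover have "finite B"
      unfolding B_def X_def using assms by simp
    ultimately show ?thesis
      using equivalent_categories_locally_determined[OF U _ BK K_open] by (simp only:)
  qed
  then show ?thesis
    using assms K unfolding X_def by (intro exI conjI allI impI)
qed

end
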